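(* Let $d\geq 2$, let $\Omega\subset\mathbb{R}^d$ be a bounded domain (nonempty connected open set), and let $\varepsilon>0$. Let $\phi:[0,+\infty)\to\mathbb{R}$ be one of the following radial functions: (a) Gaussian: $\phi(r)=e^{-r^2}$; (b) Generalized Inverse MultiQuadric: $\phi(r)=(1+r^2)^\beta$ with $\beta<0$; (c) Matérn: $\phi(r)=\frac{2^{1-\nu}}{\Gamma(\nu)}\,r^\nu K_\nu(r)$ for $r>0$, extended by continuity to $r=0$, with $\nu\in\mathbb{R}$, $\nu>1$, where $K_\nu$ is the modified Bessel function of the second kind (Macdonald function) of order $\nu$. Let $\phi_\varepsilon(r)=\phi(\varepsilon r)$. Let $m\geq 1$, let $\{Q_1,\dots,Q_m\}$ be any fixed set of $m$ distinct points on $\partial\Omega$, and let $P_1,P_2,\dots$ be a sequence of independent and identically distributed random points in $\Omega$, distributed with respect to any probability density $\sigma\in L^1_+(\Omega)$. Then for every $m\geq 1$ and every $n\geq 0$ the $(n+m)\times(n+m)$ unsymmetric Kansa collocation matrix generated by $\phi_\varepsilon$ with internal collocation points $P_1,\dots,P_n$ and boundary collocation points $Q_1,\dots,Q_m$, for the Poisson equation with Dirichlet boundary conditions in $\Omega$, is almost surely nonsingular.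
   Context: The problem being discretized is $\Delta u(P)=f(P)$ for $P\in\Omega$, $u(P)=g(P)$ for $P\in\partial\Omega$, where $\Delta=\partial^2/\partial x_1^2+\dots+\partial^2/\partial x_d^2$ is the Laplacian in $\mathbb{R}^d$. Given points $P_1,\dots,P_n\in\Omega$ and $Q_1,\dots,Q_m\in\partial\Omega$, define functions on $\mathbb{R}^d$ by $$\phi_j(P)=\phi_\varepsilon(\|P-P_j\|_2),\quad 1\leq j\leq n,\qquad \psi_k(P)=\phi_\varepsilon(\|P-Q_k\|_2),\quad 1\leq k\leq m .$$ The unsymmetric Kansa method seeks $u_N=\sum_{j=1}^n c_j\phi_j+\sum_{k=1}^m d_k\psi_k$, $N=n+m$, such that $\Delta u_N(P_i)=f(P_i)$ for $1\leq i\leq n$ and $u_N(Q_h)=g(Q_h)$ for $1\leq h\leq m$. The matrix of this linear system is the Kansa collocation matrix $$\begin{pmatrix}(\Delta\phi_j(P_i)) & (\Delta\psi_k(P_i))\\ (\phi_j(Q_h)) & (\psi_k(Q_h))\end{pmatrix},\qquad 1\leq i,j\leq n,\ 1\leq h,k\leq m,$$ where $i$ and $h$ are row indices and $j$ and $k$ are column indices. For $n=0$ it is just $(\psi_k(Q_h))_{1\leq h,k\leq m}$. $L^1_+(\Omega)$ denotes the nonnegative Lebesgue integrable functions on $\Omega$; a probability density $\sigma$ has integral $1$ over $\Omega$, and the law of each $P_i$ is $\sigma(x)\,dx$. "Almost surely" refers to the joint law of the random points $P_1,P_2,\dots$. *)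

theory Defs
  imports
    "HOL-Probability.Probability"
    "HOL-Real_Asymp.Real_Asymp"
    "Jordan_Normal_Form.Determinant"
begin

section \<open>The Macdonald function\<close>

text \<open>
  The integral representation \<open>K\<^sub>\<nu>(x) = \<integral>\<^sub>0\<^sup>\<infinity> exp (- x cosh t) cosh (\<nu> t) dt\<close> for \<open>x > 0\<close>
  (Schlaefli; DLMF 10.32.9) serves as the definition. Theorems \<open>bessel_K_ode\<close> and
  \<open>bessel_K_asymptotics\<close> below confirm that it is the solution of the modified Bessel equation
  with \<open>K\<^sub>\<nu>(x) \<sim> sqrt (\<pi> / (2 x)) exp (- x)\<close> as \<open>x \<rightarrow> \<infinity>\<close>, which characterizes \<open>K\<^sub>\<nu>\<close>
  (DLMF 10.25.3).
\<close>
definition bessel_K :: "real \<Rightarrow> real \<Rightarrow> real" where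
  "bessel_K \<nu> x = (LBINT t:{0..}. exp (- (x * cosh t)) * cosh (\<nu> * t))"

definition bessel_K_moment :: "nat \<Rightarrow> real \<Rightarrow> real \<Rightarrow> real" where
  "bessel_K_moment p \<nu> x = (LBINT t:{0..}. cosh t ^ p * (exp (- (x * cosh t)) * cosh (\<nu> * t)))"

lemma borel_measurable_cosh [measurable]: "(cosh :: real \<Rightarrow> real) \<in> borel_measurable borel"
  by (intro borel_measurable_continuous_onI continuous_intros)

lemma set_integrable_exp_minus: "set_integrable lborel {0..} (\<lambda>t::real. exp (- t))"
proof -
  have "AE t in lborel. t \<noteq> (0::real)"
    by (rule AE_lborel_singleton)
  then have ae: "AE t in lborel. indicator {0<..} t *\<^sub>R exp (- (t * 1)) = indicator {0..} t *\<^sub>R exp (- t::real)"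
    by eventually_elim (auto simp: indicator_def)
  show ?thesis
    using integrable_I0i_exp_mscale[of 1] integrable_cong_AE[OF _ _ ae]
    by (simp add: set_integrable_def)
qed

lemma cosh_real_bounds:
  fixes t :: real
  assumes "0 \<le> t"
  shows "t\<^sup>2 / 4 \<le> cosh t" "cosh t \<le> exp t"
proof -
  have "t\<^sup>2 / 2 \<le> exp t"
    using exp_lower_Taylor_quadratic[OF assms] assms by linarith
  moreover have "exp t / 2 \<le> cosh t"
    by (simp add: cosh_def)
  ultimately show "t\<^sup>2 / 4 \<le> cosh t" by simp
  show "cosh t \<le> exp t"
    using sinh_plus_cosh[of t] assms by (metis le_add_same_cancel2 sinh_real_nonneg_iff)
qed

lemma bessel_K_moment_bound:
  fixes x t \<nu> :: real
  assumes "0 < x" "0 \<le> t"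
  shows "cosh t ^ p * (exp (- (x * cosh t)) * cosh (\<nu> * t)) \<le> exp ((p + \<bar>\<nu>\<bar> + 1)\<^sup>2 / x) * exp (- t)"
proof -
  have "cosh t ^ p \<le> exp t ^ p"
    by (intro power_mono cosh_real_bounds assms) simp
  also have "\<dots> = exp (p * t)"
    by (simp add: exp_of_nat_mult)
  finally have 1: "cosh t ^ p \<le> exp (p * t)" .
  have "\<bar>\<nu> * t\<bar> = \<bar>\<nu>\<bar> * t"
    using assms by (simp add: abs_mult)
  then have "cosh (\<nu> * t) = cosh (\<bar>\<nu>\<bar> * t)"
    by (metis cosh_real_abs)
  then have 2: "cosh (\<nu> * t) \<le> exp (\<bar>\<nu>\<bar> * t)"
    using cosh_real_bounds(2)[of "\<bar>\<nu>\<bar> * t"] assms by (simp only: mult_nonneg_nonneg abs_ge_zero)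
  have 3: "exp (- (x * cosh t)) \<le> exp (- (x * (t\<^sup>2 / 4)))"
    using cosh_real_bounds(1)[of t] assms by (simp add: mult_left_mono)
  have "cosh t ^ p * (exp (- (x * cosh t)) * cosh (\<nu> * t))
      \<le> exp (p * t) * (exp (- (x * (t\<^sup>2 / 4))) * exp (\<bar>\<nu>\<bar> * t))"
    using 1 2 3 by (intro mult_mono) auto
  also have "\<dots> = exp (p * t - x * (t\<^sup>2 / 4) + \<bar>\<nu>\<bar> * t)"
    by (simp add: exp_add [symmetric])
  also have "\<dots> \<le> exp ((p + \<bar>\<nu>\<bar> + 1)\<^sup>2 / x - t)"
  proof -
    define a where "a = p + \<bar>\<nu>\<bar> + 1"
    have "0 \<le> (a - x * t / 2)\<^sup>2 / x"
      using assms by simp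
    also have "\<dots> = a\<^sup>2 / x - a * t + x * (t\<^sup>2 / 4)"
      using assms by (simp add: power2_eq_square field_simps)
    finally show ?thesis
      by (simp add: a_def algebra_simps)
  qed
  also have "\<dots> = exp ((p + \<bar>\<nu>\<bar> + 1)\<^sup>2 / x) * exp (- t)"
    by (simp add: exp_add [symmetric])
  finally show ?thesis .
qed

lemma set_borel_measurable_half_line:
  fixes f :: "real \<Rightarrow> real"
  assumes "continuous_on UNIV f"
  shows "set_borel_measurable lborel {0..} f"
  using borel_measurable_continuous_onI[OF assms] by (simp add: set_borel_measurable_def)

lemma set_integrable_bessel_K_moment:
  fixes x \<nu> :: real
  assumes "0 < x"
  shows "set_integrable lborel {0..} (\<lambda>t. cosh t ^ p * (exp (- (x * cosh t)) * cosh (\<nu> * t)))"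
proof (rule set_integrable_bound)
  show "set_integrable lborel {0..} (\<lambda>t. exp ((p + \<bar>\<nu>\<bar> + 1)\<^sup>2 / x) * exp (- t))"
    using set_integrable_exp_minus by simp
  show "set_borel_measurable lborel {0..} (\<lambda>t. cosh t ^ p * (exp (- (x * cosh t)) * cosh (\<nu> * t)))"
    by (intro set_borel_measurable_half_line continuous_intros)
  show "AE t in lborel. t \<in> {0..} \<longrightarrow>
      norm (cosh t ^ p * (exp (- (x * cosh t)) * cosh (\<nu> * t)))
        \<le> norm (exp ((p + \<bar>\<nu>\<bar> + 1)\<^sup>2 / x) * exp (- t))"
    using bessel_K_moment_bound[OF assms] by (simp add: abs_mult)
qed

lemma exp_remainder_bound:
  fixes u :: real
  shows "\<bar>exp u - 1 - u\<bar> \<le> u\<^sup>2 * exp \<bar>u\<bar>"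
proof -
  have "1 + v \<le> exp v" for v :: real
    by (rule exp_ge_add_one_self)
  note e = this[of u] this[of "- u"]
  have le: "exp u - 1 \<le> u * exp u"
    using mult_right_mono[OF e(2), of "exp u"] by (simp add: exp_minus field_simps)
  have "exp u - 1 - u \<le> u * (exp u - 1)"
    using le by (simp add: algebra_simps)
  also have "\<dots> \<le> u\<^sup>2 * exp \<bar>u\<bar>"
  proof (cases "0 \<le> u")
    case True
    then show ?thesis
      using mult_left_mono[OF le True] by (simp add: power2_eq_square algebra_simps)
  next
    case False
    then have "u * (exp u - 1) \<le> u * u"
      using e(1) by (intro mult_left_mono_neg; linarith)
    also have "\<dots> \<le> u\<^sup>2 * exp \<bar>u\<bar>"
      using mult_left_mono[of 1 "exp \<bar>u\<bar>" "u\<^sup>2"] by (simp add: power2_eq_square)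
    finally show ?thesis .
  qed
  finally have "exp u - 1 - u \<le> u\<^sup>2 * exp \<bar>u\<bar>" .
  moreover have "0 \<le> exp u - 1 - u"
    using e(1) by linarith
  ultimately show ?thesis
    by (simp only: abs_of_nonneg)
qed

lemma bessel_K_moment_has_real_derivative:
  assumes "0 < x"
  shows "(bessel_K_moment p \<nu> has_real_derivative - bessel_K_moment (Suc p) \<nu> x) (at x)"
proof -
  let ?f = "\<lambda>p x t. cosh t ^ p * (exp (- (x * cosh t)) * cosh (\<nu> * t)) :: real"
  let ?C = "bessel_K_moment (p + 2) \<nu> (x / 2)"
  have key: "\<bar>bessel_K_moment p \<nu> y - bessel_K_moment p \<nu> x + (y - x) * bessel_K_moment (Suc p) \<nu> x\<bar>
      \<le> (y - x)\<^sup>2 * ?C" if "\<bar>y - x\<bar> < x / 2" for y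
  proof -
    have y: "0 < y" using that by linarith
    note int = set_integrable_bessel_K_moment[OF assms] set_integrable_bessel_K_moment[OF y]
    let ?g = "\<lambda>t. ?f p y t - ?f p x t + (y - x) * ?f (Suc p) x t"
    have intg: "set_integrable lborel {0..} ?g"
      by (intro set_integral_add set_integral_diff set_integrable_mult_right int)
    have intb: "set_integrable lborel {0..} (\<lambda>t. (y - x)\<^sup>2 * ?f (p + 2) (x / 2) t)"
      using assms by (intro set_integrable_mult_right set_integrable_bessel_K_moment) simp
    have eq: "bessel_K_moment p \<nu> y - bessel_K_moment p \<nu> x + (y - x) * bessel_K_moment (Suc p) \<nu> x
        = (LBINT t:{0..}. ?g t)"
      unfolding bessel_K_moment_def set_integral_mult_right [symmetric]
      by (simp only: set_integral_add(2)[OF set_integral_diff(1)[OF int(2) int(1)] set_integrable_mult_right[OF int(1)]]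
          set_integral_diff(2)[OF int(2) int(1)])
    have "\<bar>LBINT t:{0..}. ?g t\<bar> \<le> (LBINT t:{0..}. \<bar>?g t\<bar>)"
      using set_integral_norm_bound[OF intg] by (simp only: real_norm_def)
    also have "\<dots> \<le> (LBINT t:{0..}. (y - x)\<^sup>2 * ?f (p + 2) (x / 2) t)"
    proof (rule set_integral_mono)
      show "set_integrable lborel {0..} (\<lambda>t. \<bar>?g t\<bar>)"
        using intg by (rule set_integrable_abs)
      fix t :: real
      define c where "c = cosh t"
      have c: "0 < c" by (simp add: c_def)
      define h where "h = - ((y - x) * c)"
      have "\<bar>exp h - 1 - h\<bar> \<le> h\<^sup>2 * exp \<bar>h\<bar>"
        by (rule exp_remainder_bound)
      also have "\<dots> \<le> h\<^sup>2 * exp (x / 2 * c)"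
        using that c by (intro mult_left_mono) (auto simp: h_def abs_mult)
      finally have *: "\<bar>exp h - 1 - h\<bar> \<le> h\<^sup>2 * exp (x / 2 * c)" .
      have ey: "exp (- (y * c)) = exp (- (x * c)) * exp h"
        by (simp only: mult_exp_exp) (simp add: h_def algebra_simps)
      have ex: "exp (- (x / 2 * c)) = exp (- (x * c)) * exp (x / 2 * c)"
        by (simp only: mult_exp_exp) simp
      have "?g t = c ^ p * exp (- (x * c)) * cosh (\<nu> * t) * (exp h - 1 - h)"
        unfolding c_def[symmetric] ey by (simp add: h_def algebra_simps)
      then have "\<bar>?g t\<bar> = c ^ p * exp (- (x * c)) * cosh (\<nu> * t) * \<bar>exp h - 1 - h\<bar>"
        using c by (simp add: abs_mult)
      also have "\<dots> \<le> c ^ p * exp (- (x * c)) * cosh (\<nu> * t) * (h\<^sup>2 * exp (x / 2 * c))"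
        using c by (intro mult_left_mono *) auto
      also have "\<dots> = (y - x)\<^sup>2 * ?f (p + 2) (x / 2) t"
        unfolding c_def[symmetric] ex by (simp only: h_def power2_minus power_mult_distrib power_add mult.assoc mult.left_commute mult.commute)
      finally show "\<bar>?g t\<bar> \<le> (y - x)\<^sup>2 * ?f (p + 2) (x / 2) t" .
    qed (rule intb)
    also have "\<dots> = (y - x)\<^sup>2 * ?C"
      by (simp add: bessel_K_moment_def)
    finally show ?thesis
      unfolding eq .
  qed
  show ?thesis
    unfolding has_field_derivative_iff
  proof (rule LIM_zero_cancel, rule Lim_null_comparison)
    show "((\<lambda>y. \<bar>y - x\<bar> * ?C) \<longlongrightarrow> 0) (at x)"
      by (intro tendsto_mult_left_zero tendsto_rabs_zero LIM_zero tendsto_ident_at)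
    have "\<forall>\<^sub>F y in at x. dist y x < x / 2 \<and> y \<noteq> x"
      using assms by (auto simp: eventually_at intro!: exI[of _ "x / 2"])
    then show "\<forall>\<^sub>F y in at x. norm ((bessel_K_moment p \<nu> y - bessel_K_moment p \<nu> x) / (y - x)
        - - bessel_K_moment (Suc p) \<nu> x) \<le> \<bar>y - x\<bar> * ?C"
    proof eventually_elim
      case (elim y)
      then have ne: "y - x \<noteq> 0" by simp
      have sq: "(y - x)\<^sup>2 = \<bar>y - x\<bar> * \<bar>y - x\<bar>"
        by (simp add: power2_eq_square)
      let ?D = "bessel_K_moment p \<nu> y - bessel_K_moment p \<nu> x + (y - x) * bessel_K_moment (Suc p) \<nu> x"
      have "(bessel_K_moment p \<nu> y - bessel_K_moment p \<nu> x) / (y - x) - - bessel_K_moment (Suc p) \<nu> x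
          = ?D / (y - x)"
        using ne by (simp add: field_simps)
      also have "norm \<dots> = \<bar>?D\<bar> / \<bar>y - x\<bar>"
        by (simp only: real_norm_def abs_divide)
      also have "\<dots> \<le> ((y - x)\<^sup>2 * ?C) / \<bar>y - x\<bar>"
        using elim by (intro divide_right_mono key) (auto simp: dist_real_def)
      also have "\<dots> = \<bar>y - x\<bar> * ?C"
        using ne by (simp add: sq del: abs_mult_self_eq)
      finally show ?case .
    qed
  qed
qed

lemma bessel_K_eq_moment: "bessel_K \<nu> = bessel_K_moment 0 \<nu>"
  by (simp add: fun_eq_iff bessel_K_def bessel_K_moment_def)

lemma bessel_K_moment_identity:
  assumes "0 < x"
  shows "x\<^sup>2 * bessel_K_moment 2 \<nu> x - x * bessel_K_moment 1 \<nu> x - (x\<^sup>2 + \<nu>\<^sup>2) * bessel_K_moment 0 \<nu> x = 0"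
proof -
  let ?f = "\<lambda>p t. cosh t ^ p * (exp (- (x * cosh t)) * cosh (\<nu> * t)) :: real"
  let ?g = "\<lambda>t. x\<^sup>2 * ?f 2 t - x * ?f 1 t - (x\<^sup>2 + \<nu>\<^sup>2) * ?f 0 t"
  let ?B = "\<lambda>t. - (x * sinh t * exp (- (x * cosh t)) * cosh (\<nu> * t)) - \<nu> * exp (- (x * cosh t)) * sinh (\<nu> * t) :: real"
  note int = set_integrable_bessel_K_moment[OF assms]
  have intg: "set_integrable lborel {0..} ?g"
    by (intro set_integral_diff set_integrable_mult_right int)
  have "x\<^sup>2 * bessel_K_moment 2 \<nu> x - x * bessel_K_moment 1 \<nu> x - (x\<^sup>2 + \<nu>\<^sup>2) * bessel_K_moment 0 \<nu> x
      = (LBINT t:{0..}. ?g t)"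
    unfolding bessel_K_moment_def set_integral_mult_right [symmetric]
    by (simp only:
        set_integral_diff(2)[OF set_integral_diff(1)[OF set_integrable_mult_right[OF int] set_integrable_mult_right[OF int]]
          set_integrable_mult_right[OF int]]
        set_integral_diff(2)[OF set_integrable_mult_right[OF int] set_integrable_mult_right[OF int]])
  also have "\<dots> = (LBINT t=0..\<infinity>. ?g t)"
  proof -
    have "AE t in lborel. t \<noteq> (0::real)"
      by (rule AE_lborel_singleton)
    then have "AE t in lborel. indicator {0..} t *\<^sub>R ?g t = indicator {0<..} t *\<^sub>R ?g t"
      by eventually_elim (auto simp: indicator_def)
    then have "(LBINT t:{0..}. ?g t) = (LBINT t:{0<..}. ?g t)"
      unfolding set_lebesgue_integral_def by (intro integral_cong_AE) measurable
    then show ?thesis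
      by (simp add: interval_lebesgue_integral_0_infty)
  qed
  also have "\<dots> = 0 - 0"
  proof (rule interval_integral_FTC_integrable[where F = ?B])
    show "(0::ereal) < \<infinity>" by simp
    show "(?B has_vector_derivative ?g t) (at t)" for t
    proof -
      have alg1: "- (((0 * s + c * 1 * x) * e + e * - (0 * c + s * 1 * x) * (x * s)) * C
              + S * (0 * t + 1 * \<nu>) * (x * s * e))
            - ((0 * e + e * - (0 * c + s * 1 * x) * \<nu>) * S + C * (0 * t + 1 * \<nu>) * (\<nu> * e))
          = - (x * (c * e * C + s * (e * - (x * s)) * C + s * e * (S * \<nu>)))
            - \<nu> * (e * - (x * s) * S + e * (C * \<nu>))" for c s e C S :: real
        by (simp add: algebra_simps)
      have alg2: "- (x * (c * e * C + s * (e * - (x * s)) * C + s * e * (S * \<nu>)))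
            - \<nu> * (e * - (x * s) * S + e * (C * \<nu>))
          = x\<^sup>2 * ((s\<^sup>2 + 1) * (e * C)) - x * (c * (e * C)) - (x\<^sup>2 + \<nu>\<^sup>2) * (1 * (e * C))"
        for c s e C S :: real
        by (simp add: power2_eq_square algebra_simps)
      have "(?B has_real_derivative ?g t) (at t)"
      proof (rule DERIV_cong)
        show "(?B has_real_derivative
            (- (x * (cosh t * exp (- (x * cosh t)) * cosh (\<nu> * t)
                + sinh t * (exp (- (x * cosh t)) * - (x * sinh t)) * cosh (\<nu> * t)
                + sinh t * exp (- (x * cosh t)) * (sinh (\<nu> * t) * \<nu>)))
             - \<nu> * (exp (- (x * cosh t)) * - (x * sinh t) * sinh (\<nu> * t)
                + exp (- (x * cosh t)) * (cosh (\<nu> * t) * \<nu>)))) (at t)"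
          by (rule derivative_eq_intros refl)+ (rule alg1)
        have c2: "(cosh t)\<^sup>2 = (sinh t)\<^sup>2 + 1"
          by (rule cosh_square_eq)
        show "(- (x * (cosh t * exp (- (x * cosh t)) * cosh (\<nu> * t)
                + sinh t * (exp (- (x * cosh t)) * - (x * sinh t)) * cosh (\<nu> * t)
                + sinh t * exp (- (x * cosh t)) * (sinh (\<nu> * t) * \<nu>)))
             - \<nu> * (exp (- (x * cosh t)) * - (x * sinh t) * sinh (\<nu> * t)
                + exp (- (x * cosh t)) * (cosh (\<nu> * t) * \<nu>))) = ?g t"
          unfolding c2 power_0 power_one_right by (rule alg2)
      qed
      then show ?thesis
        by (simp add: has_real_derivative_iff_has_vector_derivative)
    qed
    show "isCont ?g t" for t
      by (intro continuous_intros)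
    show "set_integrable lborel (einterval 0 \<infinity>) ?g"
      by (rule set_integrable_subset[OF intg]) (auto simp: einterval_def)
    have "(?B \<longlongrightarrow> ?B 0) (at_right 0)"
      by (intro tendsto_intros)
    then show "((?B \<circ> real_of_ereal) \<longlongrightarrow> 0) (at_right 0)"
      by (simp add: ereal_tendsto_simps zero_ereal_def)
    have "(?B \<longlongrightarrow> 0) at_top"
    proof (rule Lim_null_comparison)
      let ?C = "x * exp ((1 + \<bar>\<nu>\<bar> + 1)\<^sup>2 / x) + \<bar>\<nu>\<bar> * exp ((0 + \<bar>\<nu>\<bar> + 1)\<^sup>2 / x)"
      have "((\<lambda>t. exp (- t) :: real) \<longlongrightarrow> 0) at_top"
        by real_asymp
      then show "((\<lambda>t. ?C * exp (- t)) \<longlongrightarrow> 0) at_top"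
        by (rule tendsto_mult_right_zero)
      show "\<forall>\<^sub>F t in at_top. norm (?B t) \<le> ?C * exp (- t)"
        using eventually_ge_at_top[of 0]
      proof eventually_elim
        case (elim t)
        have s: "\<bar>sinh y\<bar> \<le> cosh y" for y :: real
          using sinh_less_cosh_real[of y] sinh_less_cosh_real[of "-y"] by auto
        have "norm (?B t) \<le> \<bar>x * sinh t * exp (- (x * cosh t)) * cosh (\<nu> * t)\<bar> + \<bar>\<nu> * exp (- (x * cosh t)) * sinh (\<nu> * t)\<bar>"
          by simp
        also have "\<dots> = x * (\<bar>sinh t\<bar> * (exp (- (x * cosh t)) * cosh (\<nu> * t))) + \<bar>\<nu>\<bar> * (exp (- (x * cosh t)) * \<bar>sinh (\<nu> * t)\<bar>)"
          using assms by (simp add: abs_mult)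
        also have "\<dots> \<le> x * ?f 1 t + \<bar>\<nu>\<bar> * ?f 0 t"
          using assms s by (intro add_mono mult_left_mono) (auto intro!: mult_right_mono simp: )
        also have "\<dots> \<le> x * (exp ((1 + \<bar>\<nu>\<bar> + 1)\<^sup>2 / x) * exp (- t)) + \<bar>\<nu>\<bar> * (exp ((0 + \<bar>\<nu>\<bar> + 1)\<^sup>2 / x) * exp (- t))"
          using bessel_K_moment_bound[OF assms elim, of 1 \<nu>] bessel_K_moment_bound[OF assms elim, of 0 \<nu>] assms
          by (intro add_mono mult_left_mono) auto
        finally show ?case by (simp add: algebra_simps)
      qed
    qed
    then show "((?B \<circ> real_of_ereal) \<longlongrightarrow> 0) (at_left \<infinity>)"
      by (simp add: ereal_tendsto_simps)
  qed
  finally show ?thesis by simp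
qed

theorem bessel_K_ode:
  assumes "0 < x"
  shows "x\<^sup>2 * deriv (deriv (bessel_K \<nu>)) x + x * deriv (bessel_K \<nu>) x = (x\<^sup>2 + \<nu>\<^sup>2) * bessel_K \<nu> x"
proof -
  have d: "deriv (bessel_K \<nu>) y = - bessel_K_moment 1 \<nu> y" if "0 < y" for y
    using bessel_K_moment_has_real_derivative[OF that, of 0 \<nu>]
    by (simp add: bessel_K_eq_moment DERIV_imp_deriv)
  have "\<forall>\<^sub>F y in nhds x. y \<in> {0<..}"
    using assms by (intro eventually_nhds_in_open) auto
  then have "\<forall>\<^sub>F y in nhds x. deriv (bessel_K \<nu>) y = - bessel_K_moment 1 \<nu> y"
    by eventually_elim (simp add: d)
  then have "deriv (deriv (bessel_K \<nu>)) x = deriv (\<lambda>y. - bessel_K_moment 1 \<nu> y) x"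
    by (rule deriv_cong_ev) simp
  also have "\<dots> = bessel_K_moment 2 \<nu> x"
    using DERIV_minus[OF bessel_K_moment_has_real_derivative[OF assms, of 1 \<nu>]]
    by (intro DERIV_imp_deriv) (simp add: numeral_2_eq_2)
  finally show ?thesis
    using bessel_K_moment_identity[OF assms, of \<nu>] d[OF assms]
    by (simp add: bessel_K_eq_moment)
qed

lemma cosh_real_ge_quadratic: "1 + t\<^sup>2 / 2 \<le> cosh (t :: real)"
proof -
  have "\<bar>t / 2\<bar> \<le> \<bar>sinh (t / 2)\<bar>"
    using real_le_abs_sinh[of "t / 2"] by (simp add: sinh_def exp_minus)
  then have "(t / 2)\<^sup>2 \<le> (sinh (t / 2))\<^sup>2"
    by (simp only: abs_le_square_iff)
  moreover have "cosh t = 1 + 2 * (sinh (t / 2))\<^sup>2"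
    using cosh_double[of "t / 2"] by (simp add: cosh_square_eq)
  ultimately show ?thesis by (simp add: power_divide)
qed

theorem bessel_K_asymptotics:
  "((\<lambda>x. sqrt x * exp x * bessel_K \<nu> x) \<longlongrightarrow> sqrt (pi / 2)) at_top"
proof -
  let ?s = "\<lambda>y t. indicator {0..} t *\<^sub>R (exp (- (y\<^sup>2 * (cosh (t / y) - 1))) * cosh (\<nu> * (t / y))) :: real"
  define I where "I y = (\<integral>t. ?s y t \<partial>lborel)" for y
  have scale: "y * exp (y\<^sup>2) * bessel_K \<nu> (y\<^sup>2) = (\<integral>t. ?s y t \<partial>lborel)" if "0 < y" for y
  proof -
    have "bessel_K \<nu> (y\<^sup>2) = 1 / y * (\<integral>t. indicator {0..} (t / y) *\<^sub>R (exp (- (y\<^sup>2 * cosh (t / y))) * cosh (\<nu> * (t / y))) \<partial>lborel)"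
      using that unfolding bessel_K_def set_lebesgue_integral_def
      by (subst lborel_integral_real_affine[where c = "1 / y" and t = 0]) auto
    then have "y * exp (y\<^sup>2) * bessel_K \<nu> (y\<^sup>2)
        = (\<integral>t. exp (y\<^sup>2) * (indicator {0..} (t / y) *\<^sub>R (exp (- (y\<^sup>2 * cosh (t / y))) * cosh (\<nu> * (t / y)))) \<partial>lborel)"
      using that by simp
    also have "(\<lambda>t. exp (y\<^sup>2) * (indicator {0..} (t / y) *\<^sub>R (exp (- (y\<^sup>2 * cosh (t / y))) * cosh (\<nu> * (t / y)))))
        = ?s y"
    proof
      fix t :: real
      have "exp (- (y\<^sup>2 * (cosh (t / y) - 1))) = exp (y\<^sup>2) * exp (- (y\<^sup>2 * cosh (t / y)))"
        by (simp only: mult_exp_exp) (simp add: right_diff_distrib)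
      moreover have "(indicator {0..} (t / y) :: real) = indicator {0..} t"
        using that by (simp add: indicator_def zero_le_divide_iff)
      ultimately show "exp (y\<^sup>2) * (indicator {0..} (t / y) *\<^sub>R (exp (- (y\<^sup>2 * cosh (t / y))) * cosh (\<nu> * (t / y))))
          = ?s y t"
        by (simp only: real_scaleR_def mult.assoc mult.left_commute)
    qed
    finally show ?thesis .
  qed
  have gauss: "(\<integral>t. indicator {0..} t *\<^sub>R exp (- (t\<^sup>2 / 2)) \<partial>lborel) = sqrt (pi / 2)"
  proof -
    have "(\<integral>t. indicator {0..} t *\<^sub>R exp (- (t\<^sup>2 / 2)) \<partial>lborel)
       = sqrt 2 * (\<integral>t. indicator {0..} (sqrt 2 * t) *\<^sub>R exp (- ((sqrt 2 * t)\<^sup>2 / 2)) \<partial>lborel)"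
      by (subst lborel_integral_real_affine[where c = "sqrt 2" and t = 0]) auto
    also have "(\<integral>t. indicator {0..} (sqrt 2 * t) *\<^sub>R exp (- ((sqrt 2 * t)\<^sup>2 / 2)) \<partial>lborel)
       = (\<integral>t. indicator {0..} t *\<^sub>R exp (- t\<^sup>2) \<partial>lborel)"
      by (intro Bochner_Integration.integral_cong) (auto simp: indicator_def power_mult_distrib zero_le_mult_iff)
    also have "\<dots> = sqrt pi / 2"
      using gaussian_moment_0 by (rule has_bochner_integral_integral_eq)
    also have "sqrt 2 * (sqrt pi / 2) = sqrt (pi / 2)"
      by (simp add: real_sqrt_divide field_simps)
    finally show ?thesis .
  qed
  have "((\<lambda>y. \<integral>t. ?s y t \<partial>lborel) \<longlongrightarrow> (\<integral>t. indicator {0..} t *\<^sub>R exp (- (t\<^sup>2 / 2)) \<partial>lborel)) at_top"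
  proof (rule integral_dominated_convergence_at_top)
    show "integrable lborel (\<lambda>t. indicator {0..} t *\<^sub>R (exp ((\<bar>\<nu>\<bar> + 1)\<^sup>2) * exp (- t)))"
      using set_integrable_mult_right[OF set_integrable_exp_minus, of "exp ((\<bar>\<nu>\<bar> + 1)\<^sup>2)"]
      by (simp add: set_integrable_def)
    have "((\<lambda>y. ?s y t) \<longlongrightarrow> indicator {0..} t *\<^sub>R exp (- (t\<^sup>2 / 2))) at_top" for t
    proof (cases "0 < t")
      case True
      have "((\<lambda>y. y\<^sup>2 * (cosh (t / y) - 1)) \<longlongrightarrow> t * t / 2) at_top"
        using True unfolding cosh_def real_scaleR_def by real_asymp
      then have "((\<lambda>y. exp (- (y\<^sup>2 * (cosh (t / y) - 1)))) \<longlongrightarrow> exp (- (t * t / 2))) at_top"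
        by (intro tendsto_exp tendsto_minus)
      moreover have "((\<lambda>y. cosh (\<nu> * (t / y))) \<longlongrightarrow> cosh 0) at_top"
        by (intro tendsto_cosh) real_asymp
      ultimately have "((\<lambda>y. ?s y t) \<longlongrightarrow> indicator {0..} t *\<^sub>R (exp (- (t * t / 2)) * cosh 0)) at_top"
        by (intro tendsto_scaleR[OF tendsto_const] tendsto_mult)
      then show ?thesis by (simp only: power2_eq_square cosh_0 mult_1_right)
    next
      case False
      then show ?thesis
        by (cases "t = 0") (auto simp: indicator_def)
    qed
    then show "AE t in lborel. ((\<lambda>y. ?s y t) \<longlongrightarrow> indicator {0..} t *\<^sub>R exp (- (t\<^sup>2 / 2))) at_top"
      by (intro AE_I2)
    show "\<forall>\<^sub>F y in at_top. AE t in lborel. norm (?s y t) \<le> indicator {0..} t *\<^sub>R (exp ((\<bar>\<nu>\<bar> + 1)\<^sup>2) * exp (- t))"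
      using eventually_ge_at_top[of 1]
    proof eventually_elim
      case (elim y)
      have "exp (- (y\<^sup>2 * (cosh (t / y) - 1))) * cosh (\<nu> * (t / y)) \<le> exp ((\<bar>\<nu>\<bar> + 1)\<^sup>2) * exp (- t)"
        if t: "0 \<le> t" for t
      proof -
        have "t\<^sup>2 / 2 = y\<^sup>2 * ((t / y)\<^sup>2 / 2)"
          using elim by (simp add: power_divide)
        also have "\<dots> \<le> y\<^sup>2 * (cosh (t / y) - 1)"
          using cosh_real_ge_quadratic[of "t / y"] by (intro mult_left_mono) auto
        finally have 1: "t\<^sup>2 / 2 \<le> y\<^sup>2 * (cosh (t / y) - 1)" .
        have "\<bar>\<nu> * (t / y)\<bar> = \<bar>\<nu>\<bar> * (t / y)"
          using t elim by (simp add: abs_mult)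
        then have eq: "cosh (\<nu> * (t / y)) = cosh (\<bar>\<nu>\<bar> * (t / y))"
          by (metis cosh_real_abs)
        have "cosh (\<bar>\<nu>\<bar> * (t / y)) \<le> exp (\<bar>\<nu>\<bar> * (t / y))"
          using t elim by (intro cosh_real_bounds) simp
        moreover have "\<bar>\<nu>\<bar> * (t / y) \<le> \<bar>\<nu>\<bar> * t"
          using divide_left_mono[of 1 y t] t elim by (intro mult_left_mono) auto
        ultimately have 2: "cosh (\<nu> * (t / y)) \<le> exp (\<bar>\<nu>\<bar> * t)"
          unfolding eq by (meson exp_le_cancel_iff order_trans)
        have "exp (- (y\<^sup>2 * (cosh (t / y) - 1))) * cosh (\<nu> * (t / y)) \<le> exp (- (t\<^sup>2 / 2)) * exp (\<bar>\<nu>\<bar> * t)"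
          using 1 2 by (intro mult_mono) (simp_all only: exp_le_cancel_iff neg_le_iff_le cosh_real_nonneg exp_ge_zero)
        also have "\<dots> = exp (\<bar>\<nu>\<bar> * t - t\<^sup>2 / 2)"
          by (simp add: mult_exp_exp)
        also have "\<dots> \<le> exp ((\<bar>\<nu>\<bar> + 1)\<^sup>2 - t)"
        proof -
          have "0 \<le> (\<bar>\<nu>\<bar> + 1)\<^sup>2 / 2 + (\<bar>\<nu>\<bar> + 1 - t)\<^sup>2 / 2" by simp
          also have "\<dots> = (\<bar>\<nu>\<bar> + 1)\<^sup>2 - (\<bar>\<nu>\<bar> + 1) * t + t\<^sup>2 / 2"
            by (simp add: power2_eq_square field_simps)
          finally show ?thesis by (simp add: algebra_simps)
        qed
        finally show ?thesis by (simp add: mult_exp_exp)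
      qed
      then have "norm (?s y t) \<le> indicator {0..} t *\<^sub>R (exp ((\<bar>\<nu>\<bar> + 1)\<^sup>2) * exp (- t))" for t
        by (cases "0 \<le> t") (simp_all add: abs_mult)
      then show ?case
        by (intro AE_I2)
    qed
  qed auto
  then have lim: "(I \<longlongrightarrow> sqrt (pi / 2)) at_top"
    by (simp only: gauss I_def [abs_def])
  have "((\<lambda>x. I (sqrt x)) \<longlongrightarrow> sqrt (pi / 2)) at_top"
    by (rule filterlim_compose[OF lim sqrt_at_top])
  moreover have "\<forall>\<^sub>F x in at_top. I (sqrt x) = sqrt x * exp x * bessel_K \<nu> x"
    using eventually_gt_at_top[of 0]
  proof eventually_elim
    case (elim x)
    then show ?case
      using scale[of "sqrt x"] by (simp only: I_def real_sqrt_gt_zero real_sqrt_pow2 less_imp_le)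
  qed
  ultimately show ?thesis
    by (rule Lim_transform_eventually)
qed


section \<open>Radial functions\<close>

text \<open>Radial functions are total on \<open>real\<close>; only their values on \<open>[0, \<infinity>)\<close> are ever used.\<close>

definition gaussian :: "real \<Rightarrow> real" where
  "gaussian r = exp (- (r\<^sup>2))"

definition gimq :: "real \<Rightarrow> real \<Rightarrow> real" where
  "gimq \<beta> r = (1 + r\<^sup>2) powr \<beta>"

definition matern_pos :: "real \<Rightarrow> real \<Rightarrow> real" where
  "matern_pos \<nu> r = 2 powr (1 - \<nu>) / Gamma \<nu> * r powr \<nu> * bessel_K \<nu> r"

definition matern :: "real \<Rightarrow> real \<Rightarrow> real" where
  "matern \<nu> r = (if r = 0 then Lim (at_right 0) (matern_pos \<nu>) else matern_pos \<nu> r)"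


section \<open>The Kansa collocation matrix\<close>

definition rbf :: "(real \<Rightarrow> real) \<Rightarrow> real \<Rightarrow> 'a::euclidean_space \<Rightarrow> 'a \<Rightarrow> real" where
  "rbf \<phi> \<epsilon> c x = \<phi> (\<epsilon> * norm (x - c))"

definition partial_deriv :: "'a::euclidean_space \<Rightarrow> ('a \<Rightarrow> real) \<Rightarrow> 'a \<Rightarrow> real" where
  "partial_deriv b f x = deriv (\<lambda>t. f (x + t *\<^sub>R b)) 0"

definition laplacian :: "('a::euclidean_space \<Rightarrow> real) \<Rightarrow> 'a \<Rightarrow> real" where
  "laplacian f x = (\<Sum>b\<in>Basis. partial_deriv b (partial_deriv b f) x)"

text \<open>
  Only the points \<open>P 0, \<dots>, P (n - 1)\<close> and \<open>Q 0, \<dots>, Q (m - 1)\<close> enter, so indices start at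
  \<open>0\<close> rather than \<open>1\<close>.
\<close>
definition kansa_matrix ::
  "(real \<Rightarrow> real) \<Rightarrow> real \<Rightarrow> nat \<Rightarrow> (nat \<Rightarrow> 'a::euclidean_space) \<Rightarrow> nat \<Rightarrow> (nat \<Rightarrow> 'a) \<Rightarrow> real mat" where
  "kansa_matrix \<phi> \<epsilon> n P m Q =
     four_block_mat
       (mat n n (\<lambda>(i, j). laplacian (rbf \<phi> \<epsilon> (P j)) (P i)))
       (mat n m (\<lambda>(i, k). laplacian (rbf \<phi> \<epsilon> (Q k)) (P i)))
       (mat m n (\<lambda>(h, j). rbf \<phi> \<epsilon> (P j) (Q h)))
       (mat m m (\<lambda>(h, k). rbf \<phi> \<epsilon> (Q k) (Q h)))"

end

theory Submission
  imports Defs "HOL-Complex_Analysis.Complex_Analysis"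
begin

text \<open>
  Each of the three radial functions is a mixture of Gaussians,
  \<open>\<phi>(r) = \<integral> exp (- r\<^sup>2 h(v)) dM(v)\<close> with a finite nonzero measure \<open>M\<close>, with \<open>h > 0\<close> and with
  \<open>\<integral> h dM < \<infinity>\<close> (\<open>gaussian_mixture_representation\<close>, \<open>gimq_mixture_representation\<close>,
  \<open>matern_mixture_representation\<close>). Everything the argument needs follows from this
  representation. Write \<open>m\<^sub>k(w) = \<integral> h\<^sup>k exp (- w h) dM\<close> for the moments.

  \<^item> The collocation matrix without interior points is \<open>(m\<^sub>0(|Q\<^sub>h - Q\<^sub>k|\<^sup>2))\<close>. A mixture of strictly
    positive definite kernels is strictly positive definite, so the matrix is nonsingular because
    the Gaussian kernels are strictly positive definite (\<open>gaussian_kernel_pos\<close>).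
  \<^item> The basis functions and their Laplacians are functions of the squared distance to the centre,
    namely \<open>m\<^sub>0\<close> and \<open>4 w m\<^sub>2(w) - 2 d m\<^sub>1(w)\<close> (\<open>laplacian_rbf\<close>). Both extend holomorphically to
    the half plane \<open>Re w > 0\<close> and vanish at infinity, whereas the Laplacian at the centre itself,
    \<open>- 2 d m\<^sub>1(0)\<close>, is nonzero. Finiteness of \<open>m\<^sub>1(0)\<close> is what restricts the Matern order to
    \<open>\<nu> > 1\<close>.

  The theorem is proved by induction on \<open>n\<close>. Suppose that the matrix with \<open>n\<close> interior points is
  nonsingular, and let the next interior point \<open>x\<close> travel along a line \<open>x + t b\<close> that meets none of
  the other points. The determinant of the enlarged matrix is then real analytic in \<open>t\<close>, since it
  extends holomorphically to a strip around the real axis. As \<open>t \<rightarrow> \<infinity>\<close>, all entries in the row and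
  the column of the travelling point die out except the diagonal one, so the determinant tends to the
  product of that diagonal entry with the old determinant, which is nonzero. Hence the determinant
  has only countably many zeros on the line (\<open>countable_zeros_on_line\<close>). In dimension at least two
  almost every line in a given direction avoids finitely many points, so Fubini's theorem shows that
  the bad positions of \<open>x\<close> form a Lebesgue null set (\<open>AE_det_kansa_matrix_Suc\<close>). Because
  the new point has a density and is independent of the previous ones, it almost surely
  misses this null set (\<open>AE_det_kansa_matrix\<close>). Travelling along lines reduces the needed analyticity
  to one variable, and it lets the point leave the bounded domain, where the limit is visible.
\<close>

(* Below, the symbol denotes the inner product of a Euclidean space. *)

no_notation Matrix.scalar_prod (infix "\<bullet>" 70)


section \<open>Gaussian kernels are strictly positive definite\<close>

text \<open>
  Expanding one factor \<open>x\<^sub>i \<bullet> x\<^sub>j\<close> over the coordinates turns a form of degree \<open>k + 1\<close> into a sum of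
  forms of degree \<open>k\<close> with the weights \<open>a\<^sub>i (x\<^sub>i \<bullet> b)\<close>; degree \<open>0\<close> is a perfect square.
\<close>
lemma gram_power_nonneg:
  fixes x :: "'i \<Rightarrow> 'a::euclidean_space" and a :: "'i \<Rightarrow> real"
  shows "0 \<le> (\<Sum>i\<in>I. \<Sum>j\<in>I. a i * a j * (x i \<bullet> x j) ^ k)"
proof (induction k arbitrary: a)
  case 0
  have "(\<Sum>i\<in>I. \<Sum>j\<in>I. a i * a j) = (\<Sum>i\<in>I. a i)\<^sup>2"
    by (simp add: power2_eq_square sum_product)
  then show ?case
    by simp
next
  case (Suc k)
  have "(\<Sum>i\<in>I. \<Sum>j\<in>I. a i * a j * (x i \<bullet> x j) ^ Suc k)
      = (\<Sum>i\<in>I. \<Sum>j\<in>I. \<Sum>b\<in>Basis. (a i * (x i \<bullet> b)) * (a j * (x j \<bullet> b)) * (x i \<bullet> x j) ^ k)"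
    by (intro sum.cong refl, subst power_Suc, subst (1) euclidean_inner)
      (simp add: sum_distrib_left sum_distrib_right mult_ac)
  also have "\<dots> = (\<Sum>i\<in>I. \<Sum>b\<in>Basis. \<Sum>j\<in>I. (a i * (x i \<bullet> b)) * (a j * (x j \<bullet> b)) * (x i \<bullet> x j) ^ k)"
    by (intro sum.cong refl sum.swap)
  also have "\<dots> = (\<Sum>b\<in>Basis. \<Sum>i\<in>I. \<Sum>j\<in>I. (a i * (x i \<bullet> b)) * (a j * (x j \<bullet> b)) * (x i \<bullet> x j) ^ k)"
    by (rule sum.swap)
  also have "0 \<le> \<dots>"
    by (intro sum_nonneg Suc.IH)
  finally show ?case .
qed

lemma exp_inner_form_sums:
  fixes x :: "'i \<Rightarrow> 'a::euclidean_space" and a :: "'i \<Rightarrow> real"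
  shows "(\<lambda>k. s ^ k / fact k * (\<Sum>i\<in>I. \<Sum>j\<in>I. a i * a j * (x i \<bullet> x j) ^ k))
    sums (\<Sum>i\<in>I. \<Sum>j\<in>I. a i * a j * exp (s * (x i \<bullet> x j)))"
proof -
  have "(\<lambda>k. \<Sum>i\<in>I. \<Sum>j\<in>I. a i * a j * ((s * (x i \<bullet> x j)) ^ k /\<^sub>R fact k))
      sums (\<Sum>i\<in>I. \<Sum>j\<in>I. a i * a j * exp (s * (x i \<bullet> x j)))"
    by (intro sums_sum sums_mult exp_converges)
  moreover have "(\<Sum>i\<in>I. \<Sum>j\<in>I. a i * a j * ((s * (x i \<bullet> x j)) ^ k /\<^sub>R fact k))
      = s ^ k / fact k * (\<Sum>i\<in>I. \<Sum>j\<in>I. a i * a j * (x i \<bullet> x j) ^ k)" for k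
    by (simp add: sum_distrib_left power_mult_distrib field_simps)
  ultimately show ?thesis
    by simp
qed

text \<open>
  The form is a power series in \<open>s\<close> with nonnegative coefficients. If it vanished at one positive \<open>s\<close>,
  all coefficients would be zero and it would vanish for every \<open>s\<close>. As \<open>s \<rightarrow> \<infinity>\<close>, however, it is
  dominated by the diagonal terms of the longest vectors \<open>x\<^sub>i\<close> that carry a nonzero weight, and these
  contribute the squares \<open>a\<^sub>i\<^sup>2\<close>.
\<close>
lemma exp_inner_form_pos:
  fixes x :: "'i \<Rightarrow> 'a::euclidean_space" and a :: "'i \<Rightarrow> real"
  assumes "finite I" "inj_on x I" "0 < s" and nz: "\<exists>i\<in>I. a i \<noteq> 0"
  shows "0 < (\<Sum>i\<in>I. \<Sum>j\<in>I. a i * a j * exp (s * (x i \<bullet> x j)))"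
proof -
  define q where "q t = (\<Sum>i\<in>I. \<Sum>j\<in>I. a i * a j * exp (t * (x i \<bullet> x j)))" for t
  define g where "g k = (\<Sum>i\<in>I. \<Sum>j\<in>I. a i * a j * (x i \<bullet> x j) ^ k)" for k
  have sums: "(\<lambda>k. t ^ k / fact k * g k) sums q t" for t
    unfolding q_def g_def by (rule exp_inner_form_sums)
  have g: "0 \<le> g k" for k
    unfolding g_def by (rule gram_power_nonneg)
  have q0: "q s \<noteq> 0"
  proof
    assume "q s = 0"
    then have "s ^ k / fact k * g k = 0" for k
      using sums[of s] g \<open>0 < s\<close> suminf_eq_zero_iff[of "\<lambda>k. s ^ k / fact k * g k"]
      by (simp add: sums_iff)
    then have "g k = 0" for k
      using \<open>0 < s\<close> by simp
    then have zero: "q t = 0" for t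
      using sums[of t] by (simp add: sums_iff)
    define J where "J = {i \<in> I. a i \<noteq> 0}"
    define R where "R = Max ((\<lambda>i. x i \<bullet> x i) ` J)"
    have J: "finite J" "J \<noteq> {}" "J \<subseteq> I"
      using assms by (auto simp: J_def)
    have R: "x i \<bullet> x i \<le> R" if "i \<in> J" for i
      unfolding R_def using J that by (intro Max_ge) auto
    have "R \<in> (\<lambda>i. x i \<bullet> x i) ` J"
      unfolding R_def using J by (intro Max_in) auto
    then obtain i0 where i0: "i0 \<in> J" "x i0 \<bullet> x i0 = R"
      by auto
    \<comment> \<open>Off the diagonal the inner product is strictly smaller than the maximal squared length.\<close>
    have less: "x i \<bullet> x j < R" if "i \<in> J" "j \<in> J" "i \<noteq> j" for i j
    proof -
      have "x i \<noteq> x j"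
        using that J \<open>inj_on x I\<close> by (auto dest: inj_onD)
      then have "0 < (x i - x j) \<bullet> (x i - x j)"
        by simp
      then show ?thesis
        using R[of i] R[of j] that by (simp add: inner_diff inner_commute)
    qed
    let ?l = "\<lambda>i j. if i = j \<and> x i \<bullet> x i = R then a i * a i else 0"
    have "((\<lambda>t. \<Sum>i\<in>J. \<Sum>j\<in>J. a i * a j * exp (t * (x i \<bullet> x j - R))) \<longlongrightarrow> (\<Sum>i\<in>J. \<Sum>j\<in>J. ?l i j)) at_top"
    proof (intro tendsto_sum)
      fix i j assume ij: "i \<in> J" "j \<in> J"
      show "((\<lambda>t. a i * a j * exp (t * (x i \<bullet> x j - R))) \<longlongrightarrow> ?l i j) at_top"
      proof (cases "i = j \<and> x i \<bullet> x i = R")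
        case False
        then have "x i \<bullet> x j - R < 0"
          using less[OF ij] R[OF ij(1)] by (cases "i = j") auto
        then have "((\<lambda>t. a i * a j * exp (t * (x i \<bullet> x j - R))) \<longlongrightarrow> a i * a j * 0) at_top"
          by (intro tendsto_mult_left) real_asymp
        then show ?thesis
          using False by auto
      qed auto
    qed
    moreover have "(\<Sum>i\<in>J. \<Sum>j\<in>J. a i * a j * exp (t * (x i \<bullet> x j - R))) = 0" for t
    proof -
      have "(\<Sum>i\<in>J. \<Sum>j\<in>J. a i * a j * exp (t * (x i \<bullet> x j - R)))
          = exp (- t * R) * (\<Sum>i\<in>J. \<Sum>j\<in>J. a i * a j * exp (t * (x i \<bullet> x j)))"
        by (simp add: sum_distrib_left right_diff_distrib exp_diff exp_minus field_simps)
      also have "(\<Sum>i\<in>J. \<Sum>j\<in>J. a i * a j * exp (t * (x i \<bullet> x j)))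
          = (\<Sum>i\<in>J. \<Sum>j\<in>I. a i * a j * exp (t * (x i \<bullet> x j)))"
        using J assms by (intro sum.cong refl sum.mono_neutral_left) (auto simp: J_def)
      also have "\<dots> = q t"
        unfolding q_def using J assms by (intro sum.mono_neutral_left) (auto simp: J_def)
      finally show ?thesis
        using zero by simp
    qed
    ultimately have "(\<Sum>i\<in>J. \<Sum>j\<in>J. ?l i j) = 0"
      by (simp add: tendsto_const_iff)
    moreover have "0 < (\<Sum>i\<in>J. \<Sum>j\<in>J. ?l i j)"
    proof (rule sum_pos2[OF J(1) i0(1)])
      show "0 < (\<Sum>j\<in>J. ?l i0 j)"
        using i0 J by (intro sum_pos2[of J i0]) (auto simp: J_def zero_less_mult_iff)
      show "0 \<le> (\<Sum>j\<in>J. ?l i j)" for i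
        by (intro sum_nonneg) auto
    qed
    ultimately show False
      by simp
  qed
  moreover have "0 \<le> q s"
    using sums_le[OF _ sums_zero sums[of s]] g \<open>0 < s\<close> by simp
  ultimately show ?thesis
    unfolding q_def by linarith
qed

text \<open>
  The identity \<open>|x - y|\<^sup>2 = |x|\<^sup>2 + |y|\<^sup>2 - 2 x \<bullet> y\<close> absorbs the Gaussian into the weights and leaves
  the exponential of the inner product.
\<close>
lemma gaussian_kernel_pos:
  fixes x :: "'i \<Rightarrow> 'a::euclidean_space" and c :: "'i \<Rightarrow> real"
  assumes "finite I" "inj_on x I" "0 < s" "\<exists>i\<in>I. c i \<noteq> 0"
  shows "0 < (\<Sum>i\<in>I. \<Sum>j\<in>I. c i * c j * exp (- ((norm (x i - x j))\<^sup>2 * s)))"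
proof -
  define a where "a i = c i * exp (- (s * (x i \<bullet> x i)))" for i
  have "c i * c j * exp (- ((norm (x i - x j))\<^sup>2 * s)) = a i * a j * exp (2 * s * (x i \<bullet> x j))" for i j
  proof -
    have "- ((norm (x i - x j))\<^sup>2 * s) = - (s * (x i \<bullet> x i)) + - (s * (x j \<bullet> x j)) + 2 * s * (x i \<bullet> x j)"
      by (simp add: power2_norm_eq_inner inner_diff inner_commute algebra_simps)
    then show ?thesis
      by (simp only: exp_add a_def mult_ac)
  qed
  moreover have "0 < (\<Sum>i\<in>I. \<Sum>j\<in>I. a i * a j * exp (2 * s * (x i \<bullet> x j)))"
    using assms by (intro exp_inner_form_pos) (auto simp: a_def)
  ultimately show ?thesis
    by simp
qed


section \<open>Gaussian mixtures and their moments\<close>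

lemma power_times_exp_bound:
  fixes d y :: real
  assumes "0 < d" "0 \<le> y"
  shows "y ^ k * exp (- (d * y)) \<le> fact k / d ^ k"
proof -
  have "(d * y) ^ k /\<^sub>R fact k \<le> exp (d * y)"
    using sum_le_suminf[OF summable_exp_generic, of "{k}" "d * y"] assms
    by (simp add: exp_def zero_le_mult_iff)
  then show ?thesis
    using assms by (simp add: exp_minus field_simps power_mult_distrib)
qed

text \<open>
  A finite measure suffices for the radial function itself; integrability of \<open>h\<close> makes it
  twice differentiable at the centre.
\<close>
locale gaussian_mixture = finite_measure M for M :: "'v measure" +
  fixes h :: "'v \<Rightarrow> real"
  assumes h_measurable [measurable]: "h \<in> borel_measurable M"
    and h_pos: "\<And>v. 0 < h v"
    and h_integrable: "integrable M h"
    and nontrivial: "emeasure M (space M) \<noteq> 0"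
begin

definition moment :: "nat \<Rightarrow> real \<Rightarrow> real" where
  "moment k w = (\<integral>v. h v ^ k * exp (- (w * h v)) \<partial>M)"

definition complex_moment :: "nat \<Rightarrow> complex \<Rightarrow> complex" where
  "complex_moment k w = (\<integral>v. of_real (h v ^ k) * exp (- (w * of_real (h v))) \<partial>M)"

lemma integrable_complex_moment:
  assumes "0 < Re w"
  shows "integrable M (\<lambda>v. of_real (h v ^ k) * exp (- (w * of_real (h v))))"
proof (rule integrable_const_bound)
  show "AE v in M. norm (of_real (h v ^ k) * exp (- (w * of_real (h v)))) \<le> fact k / Re w ^ k"
    using power_times_exp_bound[OF assms] h_pos
    by (intro AE_I2) (simp add: norm_mult norm_power less_imp_le)
qed measurable

lemma integrable_moment:
  assumes "0 < w"
  shows "integrable M (\<lambda>v. h v ^ k * exp (- (w * h v)))"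
proof (rule integrable_const_bound)
  show "AE v in M. norm (h v ^ k * exp (- (w * h v))) \<le> fact k / w ^ k"
    using power_times_exp_bound[OF assms] h_pos
    by (intro AE_I2) (simp add: norm_mult norm_power less_imp_le)
qed measurable

lemma integrable_moment_0: "0 \<le> w \<Longrightarrow> integrable M (\<lambda>v. exp (- (w * h v)))"
  using h_pos by (intro integrable_const_bound[where B = 1] AE_I2) (auto simp: less_imp_le)

lemma complex_moment_of_real: "complex_moment k (of_real w) = of_real (moment k w)"
  unfolding complex_moment_def moment_def integral_complex_of_real [symmetric]
  by (simp add: exp_of_real [symmetric] del: of_real_power)

text \<open>
  Differentiation under the integral sign: within distance \<open>Re w / 2\<close> of \<open>w\<close> the difference quotients
  are dominated by the integrand of the next moment at \<open>Re w / 2\<close>.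
\<close>
lemma complex_moment_has_derivative:
  assumes w: "0 < Re w"
  shows "(complex_moment k has_field_derivative - complex_moment (Suc k) w) (at w)"
proof -
  define d where "d = Re w / 2"
  have d: "0 < d" using w by (simp add: d_def)
  define f :: "complex \<Rightarrow> 'v \<Rightarrow> complex"
    where "f z v = of_real (h v ^ k) * exp (- (z * of_real (h v)))" for z v
  have moment_f: "complex_moment k z = (\<integral>v. f z v \<partial>M)" for z
    by (simp only: complex_moment_def f_def)
  have ball: "d < Re z" if "z \<in> ball w d" for z
  proof -
    have "\<bar>Re (w - z)\<bar> < d"
      using that abs_Re_le_cmod[of "w - z"] by (simp add: dist_norm)
    then show ?thesis
      unfolding d_def minus_complex.sel by linarith
  qed
  have lip: "norm (f z v - f w v) \<le> h v ^ Suc k * exp (- (d * h v)) * norm (z - w)"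
    if "z \<in> ball w d" for z v
  proof (rule field_differentiable_bound)
    show "convex (ball w d)" "z \<in> ball w d" "w \<in> ball w d"
      using that d by auto
    fix u assume u: "u \<in> ball w d"
    show "((\<lambda>z. f z v) has_field_derivative of_real (h v ^ k) * (exp (- (u * of_real (h v))) * - of_real (h v)))
        (at u within ball w d)"
      unfolding f_def by (auto intro!: derivative_eq_intros)
    have "exp (- (Re u * h v)) \<le> exp (- (d * h v))"
      using ball[OF u] h_pos[of v] by simp
    then show "norm (of_real (h v ^ k) * (exp (- (u * of_real (h v))) * - of_real (h v)))
        \<le> h v ^ Suc k * exp (- (d * h v))"
      using h_pos[of v] by (simp add: norm_mult norm_power mult_ac mult_left_mono)
  qed
  show ?thesis
    unfolding has_field_derivative_iff tendsto_at_iff_sequentially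
  proof safe
    fix X :: "nat \<Rightarrow> complex"
    assume X: "\<forall>i. X i \<in> UNIV - {w}" and lim: "X \<longlonglongrightarrow> w"
    have "\<forall>\<^sub>F i in sequentially. X i \<in> ball w d"
      using lim d by (intro topological_tendstoD) auto
    then obtain N where "\<And>n. n \<ge> N \<Longrightarrow> X n \<in> ball w d"
      by (auto simp: eventually_sequentially)
    then have N: "X (i + N) \<in> ball w d" for i
      by simp
    define Y where "Y i = X (i + N)" for i
    have Y: "Y i \<in> ball w d" "Y i \<noteq> w" for i
      using N X by (auto simp: Y_def)
    have Ylim: "Y \<longlonglongrightarrow> w"
      unfolding Y_def using lim by (rule LIMSEQ_ignore_initial_segment)
    have int: "integrable M (f z)" if "0 < Re z" for z
      unfolding f_def using that by (rule integrable_complex_moment)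
    have "(\<lambda>i. \<integral>v. (f (Y i) v - f w v) / (Y i - w) \<partial>M)
        \<longlonglongrightarrow> (\<integral>v. of_real (h v ^ k) * (exp (- (w * of_real (h v))) * - of_real (h v)) \<partial>M)"
    proof (rule integral_dominated_convergence)
      show "integrable M (\<lambda>v. h v ^ Suc k * exp (- (d * h v)))"
        using d by (rule integrable_moment)
      show "AE v in M. (\<lambda>i. (f (Y i) v - f w v) / (Y i - w))
          \<longlonglongrightarrow> of_real (h v ^ k) * (exp (- (w * of_real (h v))) * - of_real (h v))"
      proof (intro AE_I2)
        fix v
        have "((\<lambda>z. f z v) has_field_derivative of_real (h v ^ k) * (exp (- (w * of_real (h v))) * - of_real (h v))) (at w)"
          unfolding f_def by (auto intro!: derivative_eq_intros)
        then show "(\<lambda>i. (f (Y i) v - f w v) / (Y i - w))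
          \<longlonglongrightarrow> of_real (h v ^ k) * (exp (- (w * of_real (h v))) * - of_real (h v))"
          unfolding has_field_derivative_iff tendsto_at_iff_sequentially
          using Y Ylim by (auto simp: o_def)
      qed
      show "AE v in M. norm ((f (Y i) v - f w v) / (Y i - w)) \<le> h v ^ Suc k * exp (- (d * h v))" for i
        using lip[OF Y(1)] Y(2)[of i] by (intro AE_I2) (simp add: norm_divide divide_le_eq)
    qed (auto simp: f_def)
    also have "(\<integral>v. of_real (h v ^ k) * (exp (- (w * of_real (h v))) * - of_real (h v)) \<partial>M)
        = - complex_moment (Suc k) w"
      unfolding complex_moment_def integral_minus [symmetric]
      by (intro Bochner_Integration.integral_cong refl) simp
    also have "(\<lambda>i. \<integral>v. (f (Y i) v - f w v) / (Y i - w) \<partial>M)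
        = (\<lambda>i. (complex_moment k (Y i) - complex_moment k w) / (Y i - w))"
    proof
      fix i
      have "0 < Re (Y i)"
        using ball[OF Y(1), of i] d by simp
      then show "(\<integral>v. (f (Y i) v - f w v) / (Y i - w) \<partial>M)
          = (complex_moment k (Y i) - complex_moment k w) / (Y i - w)"
        using int w by (simp add: moment_f)
    qed
    finally show "((\<lambda>z. (complex_moment k z - complex_moment k w) / (z - w)) \<circ> X) \<longlonglongrightarrow> - complex_moment (Suc k) w"
      unfolding Y_def o_def by (rule LIMSEQ_offset)
  qed
qed

lemma complex_moment_holomorphic: "complex_moment k holomorphic_on {w. 0 < Re w}"
  using complex_moment_has_derivative
  by (auto simp: holomorphic_on_def field_differentiable_def intro: has_field_derivative_at_within)

lemma moment_has_derivative:
  assumes "0 < w"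
  shows "(moment k has_real_derivative - moment (Suc k) w) (at w)"
proof -
  have "((\<lambda>x. Re (complex_moment k (of_real x))) has_real_derivative Re (- complex_moment (Suc k) (of_real w))) (at w)"
    using complex_moment_has_derivative[of "of_real w" k] assms
    by (intro has_field_derivative_Re has_vector_derivative_real_field) auto
  then show ?thesis
    by (simp add: complex_moment_of_real)
qed

lemma moment_measurable [measurable]: "moment k \<in> borel_measurable borel"
  unfolding moment_def by measurable

lemma moment_nonneg: "0 \<le> moment k w"
  unfolding moment_def using h_pos by (intro Bochner_Integration.integral_nonneg) (simp add: less_imp_le)

lemma moment_1_0_pos: "0 < moment 1 0"
proof -
  have "0 \<le> moment 1 0"
    by (rule moment_nonneg)
  moreover have "moment 1 0 \<noteq> 0"
  proof
    assume "moment 1 0 = 0"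
    then have "AE v in M. h v = 0"
      unfolding moment_def using h_pos h_integrable
      by (subst (asm) integral_nonneg_eq_0_iff_AE) (auto simp: less_imp_le)
    then have "AE v in M. False"
      by eventually_elim (metis h_pos less_irrefl)
    then show False
      using nontrivial by (simp add: AE_iff_null null_sets_def)
  qed
  ultimately show ?thesis
    by linarith
qed

lemma moment_tendsto_0: "(moment k \<longlongrightarrow> 0) at_top"
proof -
  have "((\<lambda>w. \<integral>v. h v ^ k * exp (- (w * h v)) \<partial>M) \<longlongrightarrow> (\<integral>v. 0 \<partial>M)) at_top"
  proof (rule integral_dominated_convergence_at_top)
    show "integrable M (\<lambda>v. h v ^ k * exp (- (1 * h v)))"
      by (rule integrable_moment) simp
    show "\<forall>\<^sub>F w in at_top. AE v in M. norm (h v ^ k * exp (- (w * h v))) \<le> h v ^ k * exp (- (1 * h v))"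
      using eventually_ge_at_top[of 1]
      by eventually_elim (auto simp: norm_mult norm_power abs_of_pos[OF h_pos] h_pos less_imp_le intro!: mult_left_mono)
    have "((\<lambda>w. h v ^ k * exp (- (w * h v))) \<longlongrightarrow> 0) at_top" for v
    proof -
      have "((\<lambda>w. h v ^ k * exp (- (w * h v))) \<longlongrightarrow> h v ^ k * 0) at_top"
        using h_pos[of v] by (intro tendsto_mult_left) real_asymp
      then show ?thesis by simp
    qed
    then show "AE v in M. ((\<lambda>w. h v ^ k * exp (- (w * h v))) \<longlongrightarrow> 0) at_top"
      by simp
  qed auto
  then show ?thesis
    by (simp add: moment_def [abs_def])
qed

text \<open>
  With \<open>y = w h / 2\<close>, the bound \<open>y exp (- y) \<le> 1\<close> trades the factor \<open>w h\<close> for halving the argument.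
\<close>
lemma weighted_moment_tendsto_0: "((\<lambda>w. w * moment (Suc k) w) \<longlongrightarrow> 0) at_top"
proof (rule tendsto_sandwich[OF _ _ tendsto_const])
  show "\<forall>\<^sub>F w in at_top. 0 \<le> w * moment (Suc k) w"
    using eventually_ge_at_top[of 0] by eventually_elim (simp add: moment_nonneg)
  have "w * moment (Suc k) w \<le> 2 * moment k (w / 2)" if "0 < w" for w
  proof -
    have "w * (h v ^ Suc k * exp (- (w * h v))) \<le> 2 * (h v ^ k * exp (- (w / 2 * h v)))" for v
    proof -
      define y where "y = w / 2 * h v"
      have "y * exp (- y) \<le> 1"
        using power_times_exp_bound[of 1 y 1] that h_pos[of v] by (simp add: y_def)
      then have "2 * h v ^ k * exp (- y) * (y * exp (- y)) \<le> 2 * h v ^ k * exp (- y) * 1"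
        using h_pos[of v] by (intro mult_left_mono) (auto simp: less_imp_le)
      moreover have "exp (- (w * h v)) = exp (- y) * exp (- y)"
        unfolding y_def mult_exp_exp by simp
      ultimately show ?thesis
        by (simp add: y_def mult_ac)
    qed
    then show ?thesis
      unfolding moment_def integral_mult_right_zero [symmetric]
      using integrable_moment[of w "Suc k"] integrable_moment[of "w / 2" k] that
      by (intro integral_mono) auto
  qed
  then show "\<forall>\<^sub>F w in at_top. w * moment (Suc k) w \<le> 2 * moment k (w / 2)"
    by (intro eventually_mono[OF eventually_gt_at_top[of 0]])
  have "filterlim (\<lambda>w::real. w / 2) at_top at_top"
    by real_asymp
  from tendsto_mult_right_zero[OF filterlim_compose[OF moment_tendsto_0 this]]
  show "((\<lambda>w. 2 * moment k (w / 2)) \<longlongrightarrow> 0) at_top" .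
qed

text \<open>
  At \<open>w = 0\<close> the moments need not extend beyond the closed half plane. This bound and the one-sided
  continuity of the first moment below replace differentiability there.
\<close>
lemma moment_0_diff_bound:
  assumes "0 \<le> w"
  shows "\<bar>moment 0 w - moment 0 0\<bar> \<le> w * moment 1 0"
proof -
  have "moment 0 0 - moment 0 w = (\<integral>v. 1 - exp (- (w * h v)) \<partial>M)"
    using integrable_moment_0[OF assms] by (simp add: moment_def)
  also have "\<bar>\<dots>\<bar> \<le> (\<integral>v. w * h v \<partial>M)"
  proof (rule order_trans[OF integral_abs_bound], rule integral_mono)
    fix v
    have "1 - w * h v \<le> exp (- (w * h v))"
      using exp_ge_add_one_self[of "- (w * h v)"] by simp
    then show "\<bar>1 - exp (- (w * h v))\<bar> \<le> w * h v"
      using h_pos[of v] assms by (simp add: less_imp_le)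
  qed (use h_integrable integrable_moment_0[OF assms] in auto)
  finally show ?thesis
    by (simp add: moment_def abs_minus_commute)
qed

lemma moment_1_continuous_0: "(moment 1 \<longlongrightarrow> moment 1 0) (at_right 0)"
  unfolding tendsto_at_iff_sequentially o_def
proof safe
  fix X :: "nat \<Rightarrow> real"
  assume X: "\<forall>i. X i \<in> {0<..} - {0}" and lim: "X \<longlonglongrightarrow> 0"
  show "(\<lambda>i. moment 1 (X i)) \<longlonglongrightarrow> moment 1 0"
    unfolding moment_def
  proof (rule integral_dominated_convergence[OF _ _ h_integrable])
    show "AE v in M. (\<lambda>i. h v ^ 1 * exp (- (X i * h v))) \<longlonglongrightarrow> h v ^ 1 * exp (- (0 * h v))"
      using lim by (intro AE_I2 tendsto_intros)
    show "AE v in M. norm (h v ^ 1 * exp (- (X i * h v))) \<le> h v" for i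
    proof (intro AE_I2)
      fix v
      have "0 \<le> X i * h v"
        using X h_pos[of v] by (auto intro!: mult_nonneg_nonneg simp: less_imp_le)
      then show "norm (h v ^ 1 * exp (- (X i * h v))) \<le> h v"
        using h_pos[of v] by (simp add: norm_mult mult_left_le)
    qed
  qed auto
qed

end


section \<open>The Laplacian of a radial Gaussian mixture\<close>

lemma norm_add_scaleR_unit:
  fixes y b :: "'a::real_inner"
  assumes "norm b = 1"
  shows "(norm (y + t *\<^sub>R b))\<^sup>2 = (norm y)\<^sup>2 + 2 * t * (y \<bullet> b) + t\<^sup>2"
proof -
  have "b \<bullet> b = 1"
    using assms by (simp add: norm_eq_1)
  then show ?thesis
    unfolding power2_norm_eq_inner by (simp add: inner_simps inner_commute power2_eq_square)
qed

context gaussian_mixture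
begin

text \<open>
  The Laplacian of \<open>m\<^sub>0(|x|\<^sup>2)\<close> as a function of \<open>w = |x|\<^sup>2\<close>. The formula also holds at the centre:
  the second moment may diverge at \<open>0\<close>, in which case its integral is \<open>0\<close> by convention, but the
  factor \<open>w\<close> removes that term anyway.
\<close>
definition laplacian_profile :: "nat \<Rightarrow> real \<Rightarrow> real" where
  "laplacian_profile d w = 4 * (w * moment 2 w) - 2 * real d * moment 1 w"

lemma laplacian_profile_measurable [measurable]: "laplacian_profile d \<in> borel_measurable borel"
  unfolding laplacian_profile_def by measurable

lemma laplacian_profile_0_neg: "0 < d \<Longrightarrow> laplacian_profile d 0 < 0"
  using moment_1_0_pos by (simp add: laplacian_profile_def)

lemma laplacian_profile_tendsto_0: "(laplacian_profile d \<longlongrightarrow> 0) at_top"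
proof -
  have "((\<lambda>w. 4 * (w * moment (Suc 1) w) - 2 * real d * moment 1 w) \<longlongrightarrow> 4 * 0 - 2 * real d * 0) at_top"
    by (intro tendsto_diff tendsto_mult_left weighted_moment_tendsto_0 moment_tendsto_0)
  then show ?thesis
    by (simp add: laplacian_profile_def [abs_def] numeral_2_eq_2)
qed

context
  fixes \<phi> :: "real \<Rightarrow> real" and \<epsilon> :: real
  assumes representation: "\<And>r. 0 \<le> r \<Longrightarrow> \<phi> (\<epsilon> * r) = moment 0 (r\<^sup>2)"
begin

lemma rbf_eq_moment: "rbf \<phi> \<epsilon> c x = moment 0 ((norm (x - c))\<^sup>2)"
  by (simp add: rbf_def representation)

text \<open>
  Away from the centre this is the chain rule. At the centre the profile has only a one-sided
  difference bound, which is enough since \<open>t\<^sup>2\<close> is small of second order.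
\<close>
lemma partial_deriv_rbf:
  fixes b c :: "'a::euclidean_space"
  assumes b: "b \<in> Basis"
  shows "partial_deriv b (rbf \<phi> \<epsilon> c) x = - 2 * ((x - c) \<bullet> b) * moment 1 ((norm (x - c))\<^sup>2)"
proof -
  define y where "y = x - c"
  have sq: "(norm (x + t *\<^sub>R b - c))\<^sup>2 = (norm y)\<^sup>2 + 2 * t * (y \<bullet> b) + t\<^sup>2" for t
    using norm_add_scaleR_unit[of b y t] b by (simp add: y_def algebra_simps)
  have "((\<lambda>t. moment 0 ((norm y)\<^sup>2 + 2 * t * (y \<bullet> b) + t\<^sup>2))
      has_real_derivative - 2 * (y \<bullet> b) * moment 1 ((norm y)\<^sup>2)) (at 0)"
  proof (cases "y = 0")
    case False
    then have "(moment 0 has_real_derivative - moment (Suc 0) ((norm y)\<^sup>2 + 2 * 0 * (y \<bullet> b) + 0\<^sup>2))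
        (at ((norm y)\<^sup>2 + 2 * 0 * (y \<bullet> b) + 0\<^sup>2))"
      by (intro moment_has_derivative) simp
    then show ?thesis
      by (rule DERIV_chain2[THEN DERIV_cong]) (auto intro!: derivative_eq_intros)
  next
    case True
    have "((\<lambda>t. (moment 0 (t\<^sup>2) - moment 0 0) / t) \<longlongrightarrow> 0) (at 0)"
    proof (rule Lim_null_comparison)
      show "((\<lambda>t. \<bar>t\<bar> * moment 1 0) \<longlongrightarrow> 0) (at 0)"
        by (intro tendsto_mult_left_zero tendsto_rabs_zero tendsto_ident_at)
      have "norm ((moment 0 (t\<^sup>2) - moment 0 0) / t) \<le> \<bar>t\<bar> * moment 1 0" for t
        using moment_0_diff_bound[of "t\<^sup>2"] moment_1_0_pos
        by (cases "t = 0") (simp_all add: abs_divide divide_le_eq power2_eq_square mult_ac)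
      then show "\<forall>\<^sub>F t in at 0. norm ((moment 0 (t\<^sup>2) - moment 0 0) / t) \<le> \<bar>t\<bar> * moment 1 0"
        by simp
    qed
    then show ?thesis
      using True by (simp add: has_field_derivative_iff)
  qed
  then show ?thesis
    unfolding partial_deriv_def rbf_eq_moment sq by (simp add: DERIV_imp_deriv y_def)
qed

text \<open>
  At the centre the first derivative is \<open>- 2 t m\<^sub>1(t\<^sup>2)\<close>, whose difference quotient converges by
  one-sided continuity of \<open>m\<^sub>1\<close> alone.
\<close>
lemma second_partial_deriv_rbf:
  fixes b c :: "'a::euclidean_space"
  assumes b: "b \<in> Basis"
  shows "partial_deriv b (partial_deriv b (rbf \<phi> \<epsilon> c)) x =
    4 * ((x - c) \<bullet> b)\<^sup>2 * moment 2 ((norm (x - c))\<^sup>2) - 2 * moment 1 ((norm (x - c))\<^sup>2)"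
proof -
  define y where "y = x - c"
  have sq: "(norm (x + t *\<^sub>R b - c))\<^sup>2 = (norm y)\<^sup>2 + 2 * t * (y \<bullet> b) + t\<^sup>2" for t
    using norm_add_scaleR_unit[of b y t] b by (simp add: y_def algebra_simps)
  have lin: "(x + t *\<^sub>R b - c) \<bullet> b = y \<bullet> b + t" for t
    using b by (simp add: y_def inner_simps)
  have "((\<lambda>t. - 2 * (y \<bullet> b + t) * moment 1 ((norm y)\<^sup>2 + 2 * t * (y \<bullet> b) + t\<^sup>2))
      has_real_derivative 4 * (y \<bullet> b)\<^sup>2 * moment 2 ((norm y)\<^sup>2) - 2 * moment 1 ((norm y)\<^sup>2)) (at 0)"
  proof (cases "y = 0")
    case False
    then have "(moment 1 has_real_derivative - moment (Suc 1) ((norm y)\<^sup>2 + 2 * 0 * (y \<bullet> b) + 0\<^sup>2))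
        (at ((norm y)\<^sup>2 + 2 * 0 * (y \<bullet> b) + 0\<^sup>2))"
      by (intro moment_has_derivative) simp
    then have "((\<lambda>t. moment 1 ((norm y)\<^sup>2 + 2 * t * (y \<bullet> b) + t\<^sup>2))
        has_real_derivative - moment 2 ((norm y)\<^sup>2) * (2 * (y \<bullet> b))) (at 0)"
      by (rule DERIV_chain2[THEN DERIV_cong]) (auto intro!: derivative_eq_intros simp: numeral_2_eq_2)
    then show ?thesis
      by (auto intro!: derivative_eq_intros simp: power2_eq_square algebra_simps)
  next
    case True
    have "filterlim (\<lambda>t::real. t\<^sup>2) (at_right 0) (at 0)"
      by real_asymp
    then have "((\<lambda>t. moment 1 (t\<^sup>2)) \<longlongrightarrow> moment 1 0) (at 0)"
      by (rule filterlim_compose[OF moment_1_continuous_0])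
    then have "((\<lambda>t. - 2 * moment 1 (t\<^sup>2)) \<longlongrightarrow> - 2 * moment 1 0) (at 0)"
      by (intro tendsto_mult_left)
    moreover have "\<forall>\<^sub>F t in at 0. - 2 * moment 1 (t\<^sup>2) = (- 2 * t * moment 1 (t\<^sup>2) - 0) / (t - 0)"
      by (auto simp: eventually_at_filter)
    ultimately have "((\<lambda>t. (- 2 * t * moment 1 (t\<^sup>2) - 0) / (t - 0)) \<longlongrightarrow> - 2 * moment 1 0) (at 0)"
      by (rule Lim_transform_eventually)
    then show ?thesis
      using True by (simp add: has_field_derivative_iff)
  qed
  then show ?thesis
    unfolding partial_deriv_def[of b "partial_deriv b (rbf \<phi> \<epsilon> c)"] partial_deriv_rbf[OF b] sq lin
    by (simp add: DERIV_imp_deriv y_def)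
qed

lemma laplacian_rbf:
  fixes c x :: "'a::euclidean_space"
  shows "laplacian (rbf \<phi> \<epsilon> c) x = laplacian_profile DIM('a) ((norm (x - c))\<^sup>2)"
proof -
  have "(\<Sum>b\<in>Basis. ((x - c) \<bullet> b)\<^sup>2) = (norm (x - c))\<^sup>2"
    unfolding power2_norm_eq_inner by (subst euclidean_inner[of "x - c" "x - c"]) (simp add: power2_eq_square)
  then show ?thesis
    unfolding laplacian_def laplacian_profile_def
    by (simp add: second_partial_deriv_rbf sum_subtractf flip: sum_distrib_left sum_distrib_right)
qed

end
end


section \<open>The three radial functions as Gaussian mixtures\<close>

text \<open>
  This is Euler's integral \<open>\<Gamma>(a) / c\<^sup>a\<close> after the substitution \<open>s = exp v\<close>. In the variable \<open>v\<close>
  rescaling \<open>s\<close> is a translation, under which Lebesgue measure is invariant; the mixtures below are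
  therefore written in terms of \<open>v\<close>.
\<close>
lemma integrable_exp_minus_exp:
  fixes a c :: real
  assumes "0 < a" "0 < c"
  shows "integrable lborel (\<lambda>v. exp (a * v - c * exp v))"
proof -
  obtain k :: nat where k: "a + 1 \<le> k"
    using real_arch_simple by blast
  define e where "e v = indicator {0..} v *\<^sub>R exp (- v)" for v :: real
  have e: "integrable lborel e"
    using set_integrable_exp_minus by (simp add: e_def [abs_def] set_integrable_def)
  have "integrable lborel (\<lambda>v. fact k / c ^ k * e v + e (0 + (- a) * v))"
    using assms by (intro Bochner_Integration.integrable_add integrable_mult_right lborel_integrable_real_affine e) auto
  then show ?thesis
  proof (rule Bochner_Integration.integrable_bound)
    have "exp (a * v - c * exp v) \<le> fact k / c ^ k * e v + e (0 + (- a) * v)" for v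
    proof (cases "0 \<le> v")
      case True
      have "exp (a * v - c * exp v) = exp ((a - k) * v) * (exp v ^ k * exp (- (c * exp v)))"
        by (simp add: exp_of_nat_mult [symmetric] mult_exp_exp algebra_simps)
      also have "\<dots> \<le> exp (- v) * (fact k / c ^ k)"
        using mult_right_mono[of "a + 1" k v] k True assms
        by (intro mult_mono power_times_exp_bound) (auto simp: algebra_simps)
      also have "\<dots> = fact k / c ^ k * e v"
        using True by (simp add: e_def)
      finally show ?thesis
        by (simp add: e_def add_increasing2)
    next
      case False
      then have "exp (a * v - c * exp v) \<le> e (0 + (- a) * v)"
        using assms by (simp add: e_def mult_le_0_iff)
      then show ?thesis
        using False by (simp add: e_def)
    qed
    then show "AE v in lborel. norm (exp (a * v - c * exp v)) \<le> norm (fact k / c ^ k * e v + e (0 + (- a) * v))"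
      by (intro AE_I2) (simp add: abs_le_iff order_trans[OF _ abs_ge_self])
  qed measurable
qed

definition mixture_representation :: "(real \<Rightarrow> real) \<Rightarrow> real \<Rightarrow> bool" where
  "mixture_representation \<phi> \<epsilon> \<longleftrightarrow> (\<exists>(M :: real measure) h. gaussian_mixture M h \<and>
     (\<forall>r\<ge>0. \<phi> (\<epsilon> * r) = (\<integral>v. exp (- (r\<^sup>2 * h v)) \<partial>M)))"

text \<open>The shape parameter only rescales \<open>h\<close>, so it suffices to treat \<open>\<epsilon> = 1\<close>.\<close>
lemma mixture_representation_scale:
  assumes "mixture_representation \<phi> 1" "0 < \<epsilon>"
  shows "mixture_representation \<phi> \<epsilon>"
proof -
  obtain M :: "real measure" and h where M: "gaussian_mixture M h"
    and \<phi>: "\<And>r. 0 \<le> r \<Longrightarrow> \<phi> r = (\<integral>v. exp (- (r\<^sup>2 * h v)) \<partial>M)"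
    using assms(1) by (auto simp: mixture_representation_def)
  interpret gaussian_mixture M h
    by fact
  have "gaussian_mixture M (\<lambda>v. \<epsilon>\<^sup>2 * h v)"
    using assms(2) h_pos h_integrable nontrivial by unfold_locales auto
  moreover have "\<phi> (\<epsilon> * r) = (\<integral>v. exp (- (r\<^sup>2 * (\<epsilon>\<^sup>2 * h v))) \<partial>M)" if "0 \<le> r" for r
    using \<phi>[of "\<epsilon> * r"] assms(2) that by (simp add: power_mult_distrib mult_ac)
  ultimately show ?thesis
    unfolding mixture_representation_def by blast
qed

lemma gaussian_mixture_density:
  fixes g h :: "real \<Rightarrow> real"
  assumes [measurable]: "h \<in> borel_measurable borel"
    and pos: "\<And>v. 0 < g v" "\<And>v. 0 < h v"
    and int: "integrable lborel g" "integrable lborel (\<lambda>v. g v * h v)"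
  shows "gaussian_mixture (density lborel g) h"
proof -
  have g [measurable]: "g \<in> borel_measurable borel"
    using borel_measurable_integrable[OF int(1)] by simp
  have "integrable (density lborel g) (\<lambda>v. 1 :: real)"
    using pos int by (subst integrable_real_density) (auto simp: less_imp_le)
  then have "finite_measure (density lborel g)"
    by (intro finite_measureI) (simp add: integrable_iff_bounded less_top)
  moreover have "emeasure (density lborel g) (space (density lborel g)) \<noteq> 0"
  proof
    assume "emeasure (density lborel g) (space (density lborel g)) = 0"
    then have "AE v in lborel. ennreal (g v) = 0"
      by (simp add: emeasure_density nn_integral_0_iff_AE)
    then have "AE v in lborel :: real measure. False"
    proof eventually_elim
      case (elim v)
      then show False
        using pos(1)[of v] by simp
    qed
    then show False
      by (simp add: AE_iff_null null_sets_def)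
  qed
  moreover have "integrable (density lborel g) h"
    using pos int by (subst integrable_real_density) (auto simp: less_imp_le)
  moreover have "h \<in> borel_measurable (density lborel g)"
    by simp
  ultimately show ?thesis
    using pos(2) by (intro gaussian_mixture.intro gaussian_mixture_axioms.intro)
qed

lemma integral_gaussian_density:
  fixes g h :: "real \<Rightarrow> real"
  assumes [measurable]: "h \<in> borel_measurable borel" and "\<And>v. 0 < g v" "integrable lborel g"
  shows "(\<integral>v. exp (- (w * h v)) \<partial>density lborel g) = (\<integral>v. g v * exp (- (w * h v)) \<partial>lborel)"
proof -
  have [measurable]: "g \<in> borel_measurable borel"
    using borel_measurable_integrable[OF assms(3)] by simp
  show ?thesis
    using assms by (subst integral_real_density) (auto simp: less_imp_le)
qed

lemma gaussian_mixture_representation: "mixture_representation gaussian 1"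
proof -
  interpret prob_space "return borel (0 :: real)"
    by (rule prob_space_return) simp
  have "gaussian_mixture (return borel (0 :: real)) (\<lambda>_. 1)"
    by unfold_locales (auto simp: emeasure_space_1)
  then show ?thesis
    unfolding mixture_representation_def
    by (intro exI[of _ "return borel (0 :: real)"] exI[of _ "\<lambda>_. 1"])
      (use prob_space in \<open>auto simp: gaussian_def\<close>)
qed

text \<open>
  \<open>(1 + r\<^sup>2)\<^sup>\<beta> = \<Gamma>(- \<beta>)\<^sup>-\<^sup>1 \<integral> s\<^sup>-\<^sup>\<beta>\<^sup>-\<^sup>1 exp (- s) exp (- r\<^sup>2 s) ds\<close> with \<open>s = exp v\<close>. The normalizing
  constant is the same integral at \<open>r = 0\<close>, so translation by \<open>ln (1 + r\<^sup>2)\<close> proves the identity.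
\<close>
lemma gimq_mixture_representation:
  assumes "\<beta> < 0"
  shows "mixture_representation (gimq \<beta>) 1"
proof -
  define g where "g v = exp ((- \<beta>) * v - 1 * exp v)" for v :: real
  have int: "integrable lborel g"
    unfolding g_def [abs_def] using assms by (intro integrable_exp_minus_exp) auto
  define I where "I = (\<integral>v. g v \<partial>lborel)"
  have I: "0 < I"
  proof -
    have "0 \<le> I"
      unfolding I_def by (intro Bochner_Integration.integral_nonneg) (simp add: g_def)
    moreover have "I \<noteq> 0"
    proof
      assume "I = 0"
      then have "AE v in lborel. g v = 0"
        unfolding I_def using int by (subst (asm) integral_nonneg_eq_0_iff_AE) (auto simp: g_def)
      then show False
        by (simp add: g_def AE_iff_null null_sets_def)
    qed
    ultimately show ?thesis
      by linarith
  qed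
  have "integrable lborel (\<lambda>v. 1 / I * exp ((- \<beta> + 1) * v - 1 * exp v))"
    using assms by (intro integrable_mult_right integrable_exp_minus_exp) auto
  also have "(\<lambda>v. 1 / I * exp ((- \<beta> + 1) * v - 1 * exp v)) = (\<lambda>v. g v / I * exp v)"
    by (simp add: g_def fun_eq_iff mult_exp_exp algebra_simps)
  finally have "integrable lborel (\<lambda>v. g v / I * exp v)" .
  moreover have int_I: "integrable lborel (\<lambda>v. g v / I)"
    using int by (rule Bochner_Integration.integrable_divide)
  moreover have g_pos: "0 < g v / I" for v
    using I by (simp add: g_def)
  ultimately have "gaussian_mixture (density lborel (\<lambda>v. g v / I)) exp"
    by (intro gaussian_mixture_density) auto
  moreover have "gimq \<beta> r = (\<integral>v. exp (- (r\<^sup>2 * exp v)) \<partial>density lborel (\<lambda>v. g v / I))" for r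
  proof -
    define T where "T = 1 + r\<^sup>2"
    have r: "r\<^sup>2 = T - 1"
      by (simp add: T_def)
    have T: "0 < T"
      by (simp add: T_def add_pos_nonneg)
    have "(\<integral>v. exp (- (r\<^sup>2 * exp v)) \<partial>density lborel (\<lambda>v. g v / I))
        = (\<integral>v. g v / I * exp (- (r\<^sup>2 * exp v)) \<partial>lborel)"
      by (rule integral_gaussian_density[OF _ g_pos int_I]) simp
    also have "\<dots> = \<bar>1\<bar> *\<^sub>R (\<integral>v. g (- ln T + 1 * v) / I * exp (- (r\<^sup>2 * exp (- ln T + 1 * v))) \<partial>lborel)"
      by (rule lborel_integral_real_affine) simp
    also have "(\<lambda>v. g (- ln T + 1 * v) / I * exp (- (r\<^sup>2 * exp (- ln T + 1 * v)))) = (\<lambda>v. T powr \<beta> / I * g v)"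
    proof
      fix v
      have "exp (- ln T + 1 * v) = exp v / T"
        using exp_diff[of v "ln T"] T by simp
      moreover have "- \<beta> * (- ln T + v) - exp v / T - r\<^sup>2 * (exp v / T) = \<beta> * ln T + (- \<beta> * v - exp v)"
      proof -
        have "r\<^sup>2 * (exp v / T) = exp v - exp v / T"
          unfolding r using T by (simp add: field_simps)
        then show ?thesis
          by (simp add: algebra_simps)
      qed
      ultimately show "g (- ln T + 1 * v) / I * exp (- (r\<^sup>2 * exp (- ln T + 1 * v))) = T powr \<beta> / I * g v"
        using T by (simp add: g_def powr_def mult_exp_exp)
    qed
    also have "\<bar>1\<bar> *\<^sub>R (\<integral>v. T powr \<beta> / I * g v \<partial>lborel) = T powr \<beta>"
      using I by (simp add: I_def [symmetric])
    finally show ?thesis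
      by (simp add: gimq_def T_def)
  qed
  ultimately show ?thesis
    unfolding mixture_representation_def by (auto intro!: exI)
qed

text \<open>
  Symmetrizing \<open>K\<^sub>\<nu>(R) = \<integral>\<^sub>0\<^sup>\<infinity> exp (- R cosh t) cosh (\<nu> t) dt\<close> gives half the integral of
  \<open>exp (- R cosh t + \<nu> t)\<close> over the whole line. The translation \<open>v = t + ln R\<close> then moves \<open>R\<close> out of
  the factor \<open>exp t\<close> of the exponent, so that only \<open>exp (- v)\<close> is multiplied by \<open>R\<^sup>2\<close>.
\<close>
lemma bessel_K_eq_exp_integral:
  assumes R: "0 < R" and \<nu>: "0 < \<nu>"
  shows "R powr \<nu> * bessel_K \<nu> R =
    (\<integral>v. exp (\<nu> * v - 1 / 2 * exp v) / 2 * exp (- (R\<^sup>2 * (exp (- v) / 2))) \<partial>lborel)"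
proof -
  define g where "g v = exp (\<nu> * v - 1 / 2 * exp v) * exp (- (R\<^sup>2 * (exp (- v) / 2)))" for v
  define f where "f t = exp (- (R * cosh t)) * exp (\<nu> * t)" for t
  have int_g: "integrable lborel g"
  proof (rule Bochner_Integration.integrable_bound)
    show "integrable lborel (\<lambda>v. exp (\<nu> * v - 1 / 2 * exp v))"
      using \<nu> by (intro integrable_exp_minus_exp) auto
    show "AE v in lborel. norm (g v) \<le> norm (exp (\<nu> * v - 1 / 2 * exp v))"
      by (intro AE_I2) (simp add: g_def mult_left_le)
  qed (simp add: g_def [abs_def])
  have shift: "R powr \<nu> * f t = g (ln R + 1 * t)" for t
  proof -
    have "exp (ln R + t) = R * exp t" "exp (- (ln R + t)) = exp (- t) / R"
      using R by (simp_all add: exp_add exp_diff exp_minus field_simps)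
    then have "\<nu> * (ln R + t) - 1 / 2 * exp (ln R + t) + - (R\<^sup>2 * (exp (- (ln R + t)) / 2))
        = \<nu> * ln R + (- (R * cosh t) + \<nu> * t)"
      using R by (simp add: cosh_def field_simps power2_eq_square)
    then show ?thesis
      using R by (simp add: f_def g_def powr_def mult_exp_exp)
  qed
  have "integrable lborel (\<lambda>t. R powr \<nu> * f t)"
    unfolding shift using int_g by (rule lborel_integrable_real_affine) simp
  then have int_f: "integrable lborel f"
    using R by simp
  have int_f': "integrable lborel (\<lambda>t. f (- t))"
    using lborel_integrable_real_affine[OF int_f, of "-1" 0] by simp
  have ind: "integrable lborel (\<lambda>t. indicator A t *\<^sub>R u t)"
    if "integrable lborel u" "A \<in> sets borel" for A and u :: "real \<Rightarrow> real"
    using that by (intro integrable_mult_indicator) auto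
  have "(\<integral>t. f t \<partial>lborel) = (\<integral>t. indicator {0..} t *\<^sub>R f t + indicator {..<0} t *\<^sub>R f t \<partial>lborel)"
    by (intro Bochner_Integration.integral_cong) (auto simp: indicator_def)
  also have "\<dots> = (\<integral>t. indicator {0..} t *\<^sub>R f t \<partial>lborel) + (\<integral>t. indicator {..<0} t *\<^sub>R f t \<partial>lborel)"
    by (intro Bochner_Integration.integral_add ind int_f) auto
  also have "(\<integral>t. indicator {..<0} t *\<^sub>R f t \<partial>lborel)
      = \<bar>-1\<bar> *\<^sub>R (\<integral>t. indicator {..<0} (0 + -1 * t) *\<^sub>R f (0 + -1 * t) \<partial>lborel)"
    by (rule lborel_integral_real_affine) simp
  also have "\<dots> = (\<integral>t. indicator {0..} t *\<^sub>R f (- t) \<partial>lborel)"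
  proof -
    have "AE t in lborel. t \<noteq> (0::real)"
      by (rule AE_lborel_singleton)
    then have "AE t in lborel. indicator {..<0} (- t) *\<^sub>R f (- t) = indicator {0..} t *\<^sub>R f (- t)"
      by eventually_elim (auto simp: indicator_def)
    then show ?thesis
      using int_f' by (simp, intro integral_cong_AE) (auto intro!: borel_measurable_times dest: borel_measurable_integrable)
  qed
  also have "(\<integral>t. indicator {0..} t *\<^sub>R f t \<partial>lborel) + (\<integral>t. indicator {0..} t *\<^sub>R f (- t) \<partial>lborel)
      = (\<integral>t. indicator {0..} t *\<^sub>R f t + indicator {0..} t *\<^sub>R f (- t) \<partial>lborel)"
    by (intro Bochner_Integration.integral_add [symmetric] ind int_f int_f') auto
  also have "(\<lambda>t. indicator {0..} t *\<^sub>R f t + indicator {0..} t *\<^sub>R f (- t))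
      = (\<lambda>t. 2 * (indicator {0..} t *\<^sub>R (exp (- (R * cosh t)) * cosh (\<nu> * t))))"
  proof
    fix t
    have "cosh (\<nu> * t) = (exp (\<nu> * t) + exp (\<nu> * - t)) / 2"
      by (simp add: cosh_def)
    then show "indicator {0..} t *\<^sub>R f t + indicator {0..} t *\<^sub>R f (- t)
        = 2 * (indicator {0..} t *\<^sub>R (exp (- (R * cosh t)) * cosh (\<nu> * t)))"
      unfolding f_def by (simp only: cosh_minus real_scaleR_def) (simp add: algebra_simps)
  qed
  also have "(\<integral>t. 2 * (indicator {0..} t *\<^sub>R (exp (- (R * cosh t)) * cosh (\<nu> * t))) \<partial>lborel) = 2 * bessel_K \<nu> R"
    by (simp add: bessel_K_def set_lebesgue_integral_def)
  finally have "R powr \<nu> * bessel_K \<nu> R = (\<integral>t. R powr \<nu> * f t \<partial>lborel) / 2"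
    by simp
  also have "(\<integral>t. R powr \<nu> * f t \<partial>lborel) = (\<integral>v. g v \<partial>lborel)"
    unfolding shift using lborel_integral_real_affine[of 1 g "ln R"] by simp
  finally show ?thesis
    unfolding g_def by simp
qed

text \<open>
  Here \<open>h(v) = exp (- v) / 2\<close>, so integrating \<open>h\<close> lowers the exponent \<open>\<nu>\<close> by one; this uses \<open>\<nu> > 1\<close>.
  The value at \<open>r = 0\<close> is a limit by definition and is found from the continuity of the mixture.
\<close>
lemma matern_mixture_representation:
  assumes \<nu>: "1 < \<nu>"
  shows "mixture_representation (matern \<nu>) 1"
proof -
  define k where "k = 2 powr (1 - \<nu>) / Gamma \<nu>"
  have k: "0 < k"
    using \<nu> by (simp add: k_def Gamma_real_pos)
  define g where "g v = k * (exp (\<nu> * v - 1 / 2 * exp v) / 2)" for v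
  define h where "h v = exp (- v) / 2" for v :: real
  have int: "integrable lborel g"
    unfolding g_def [abs_def] using \<nu>
    by (intro integrable_mult_right Bochner_Integration.integrable_divide integrable_exp_minus_exp) auto
  have "integrable lborel (\<lambda>v. k / 4 * exp ((\<nu> - 1) * v - 1 / 2 * exp v))"
    using \<nu> by (intro integrable_mult_right integrable_exp_minus_exp) auto
  also have "(\<lambda>v. k / 4 * exp ((\<nu> - 1) * v - 1 / 2 * exp v)) = (\<lambda>v. g v * h v)"
    by (simp add: g_def h_def fun_eq_iff mult_exp_exp algebra_simps)
  finally have int': "integrable lborel (\<lambda>v. g v * h v)" .
  have g_pos: "0 < g v" and h_pos: "0 < h v" for v
    using k by (simp_all add: g_def h_def)
  have h [measurable]: "h \<in> borel_measurable borel"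
    by (simp add: h_def [abs_def])
  have mix: "gaussian_mixture (density lborel g) h"
    by (rule gaussian_mixture_density[OF h g_pos h_pos int int'])
  interpret gaussian_mixture "density lborel g" h
    by (rule mix)
  have pos: "matern_pos \<nu> r = moment 0 (r\<^sup>2)" if "0 < r" for r
  proof -
    have "matern_pos \<nu> r = k * (r powr \<nu> * bessel_K \<nu> r)"
      by (simp add: matern_pos_def k_def)
    also have "r powr \<nu> * bessel_K \<nu> r
        = (\<integral>v. exp (\<nu> * v - 1 / 2 * exp v) / 2 * exp (- (r\<^sup>2 * (exp (- v) / 2))) \<partial>lborel)"
      using that \<nu> by (intro bessel_K_eq_exp_integral) auto
    also have "k * \<dots> = (\<integral>v. g v * exp (- (r\<^sup>2 * h v)) \<partial>lborel)"
      unfolding integral_mult_right_zero [symmetric] g_def h_def by (simp only: mult.assoc)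
    also have "\<dots> = (\<integral>v. exp (- (r\<^sup>2 * h v)) \<partial>density lborel g)"
      by (rule integral_gaussian_density[OF h g_pos int, symmetric])
    finally show ?thesis
      by (simp add: moment_def)
  qed
  have "((\<lambda>r. moment 0 (r\<^sup>2) - moment 0 0) \<longlongrightarrow> 0) (at_right 0)"
  proof (rule Lim_null_comparison)
    show "((\<lambda>r. r\<^sup>2 * moment 1 0) \<longlongrightarrow> 0) (at_right 0)"
      by (rule tendsto_eq_intros | simp)+
    show "\<forall>\<^sub>F r in at_right 0. norm (moment 0 (r\<^sup>2) - moment 0 0) \<le> r\<^sup>2 * moment 1 0"
      by (intro always_eventually allI) (simp add: moment_0_diff_bound del: One_nat_def)
  qed
  then have "((\<lambda>r. moment 0 (r\<^sup>2)) \<longlongrightarrow> moment 0 0) (at_right 0)"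
    by (rule LIM_zero_cancel)
  moreover have "\<forall>\<^sub>F r in at_right 0. moment 0 (r\<^sup>2) = matern_pos \<nu> r"
    using eventually_at_right_less[of "0::real"] by eventually_elim (simp add: pos)
  ultimately have "(matern_pos \<nu> \<longlongrightarrow> moment 0 0) (at_right 0)"
    by (rule Lim_transform_eventually)
  then have "Lim (at_right 0) (matern_pos \<nu>) = moment 0 0"
    by (intro tendsto_Lim) auto
  then have "matern \<nu> r = moment 0 (r\<^sup>2)" if "0 \<le> r" for r
    using pos[of r] that by (cases "r = 0") (auto simp: matern_def)
  then show ?thesis
    using mix unfolding mixture_representation_def moment_def by (auto intro!: exI)
qed


section \<open>Determinants of radial matrices along a line\<close>

text \<open>
  Fubini's theorem gives one \<open>t\<close> for which the translate of \<open>Z\<close> by \<open>- t b\<close> is null, and Lebesgue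
  measure is translation invariant, so \<open>Z\<close> itself is null.
\<close>
lemma AE_lborel_of_lines:
  fixes b :: "'a::euclidean_space"
  assumes Z [measurable]: "Z \<in> sets borel"
    and lines: "AE x in lborel. AE t in lborel. x + t *\<^sub>R b \<notin> Z"
  shows "AE x in lborel. x \<notin> Z"
proof -
  have "{x \<in> space (lborel \<Otimes>\<^sub>M lborel). fst x + snd x *\<^sub>R b \<notin> Z} \<in> sets (lborel \<Otimes>\<^sub>M lborel)"
    by measurable
  then have "AE t in lborel. AE x in lborel. x + t *\<^sub>R b \<notin> Z"
    using lines by (subst (asm) lborel_pair.AE_commute) auto
  moreover have "\<not> (AE t in lborel :: real measure. False)"
    by (simp add: AE_iff_null null_sets_def)
  ultimately obtain t where "AE x in lborel. x + t *\<^sub>R b \<notin> Z"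
    by (metis (mono_tags, lifting) eventually_mono)
  then have "AE x in distr lborel borel ((+) (t *\<^sub>R b)). x \<notin> Z"
    by (subst AE_distr_iff) (auto simp: add.commute)
  then show ?thesis
    by (simp only: lborel_distr_plus)
qed

lemma AE_line_avoids:
  fixes b c :: "'a::euclidean_space"
  assumes "DIM('a) \<ge> 2"
  shows "AE x in lborel. x - c \<notin> span {b}"
proof -
  have "dim (span {b}) < DIM('a)"
    using assms dim_le_card'[of "{b}"] by (simp add: dim_span)
  then have "negligible ((+) c ` span {b})"
    by (intro negligible_translation negligible_lowdim)
  moreover have "closed ((+) c ` span {b})"
    by (intro closed_translation closed_span)
  ultimately have "(+) c ` span {b} \<in> null_sets lborel"
    by (simp add: negligible_iff_null_sets null_sets_completion_iff)
  then have "AE x in lborel. x \<notin> (+) c ` span {b}"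
    by (rule AE_not_in)
  then show ?thesis
  proof eventually_elim
    case (elim x)
    show ?case
    proof
      assume "x - c \<in> span {b}"
      then have "c + (x - c) \<in> (+) c ` span {b}"
        by (rule imageI)
      moreover have "c + (x - c) = x"
        by simp
      ultimately show False
        using elim by (simp only: not_True_eq_False)
    qed
  qed
qed

lemma permutes_less: "p permutes {0..<n} \<Longrightarrow> i < n \<Longrightarrow> p i < n" for i n :: nat
  using permutes_in_image[of p "{0..<n}" i] by simp

lemma det_mat_eq:
  "Determinant.det (mat n n (\<lambda>(i, j). E i j)) =
    (\<Sum>p | p permutes {0..<n}. of_int (sign p) * (\<Prod>i = 0..<n. E i (p i)))"
  by (subst Determinant.det_def'[of _ n])
    (auto intro!: sum.cong prod.cong simp: permutes_less)

lemma tendsto_det_mat: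
  fixes E :: "'b \<Rightarrow> nat \<Rightarrow> nat \<Rightarrow> real"
  assumes "\<And>i j. i < n \<Longrightarrow> j < n \<Longrightarrow> ((\<lambda>t. E t i j) \<longlongrightarrow> B i j) F"
  shows "((\<lambda>t. Determinant.det (mat n n (\<lambda>(i, j). E t i j))) \<longlongrightarrow> Determinant.det (mat n n (\<lambda>(i, j). B i j))) F"
  unfolding det_mat_eq
  by (intro tendsto_sum tendsto_mult tendsto_prod tendsto_const assms) (auto simp: permutes_less)

lemma holomorphic_on_det_mat:
  assumes "\<And>i j. i < n \<Longrightarrow> j < n \<Longrightarrow> (\<lambda>z. E z i j) holomorphic_on S"
  shows "(\<lambda>z. Determinant.det (mat n n (\<lambda>(i, j). E z i j))) holomorphic_on S"
  unfolding det_mat_eq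
  by (intro holomorphic_on_sum holomorphic_on_mult holomorphic_on_prod holomorphic_on_const assms)
    (auto simp: permutes_less)

lemma borel_measurable_det_mat:
  fixes E :: "'b \<Rightarrow> nat \<Rightarrow> nat \<Rightarrow> real"
  assumes "\<And>i j. i < n \<Longrightarrow> j < n \<Longrightarrow> (\<lambda>t. E t i j) \<in> borel_measurable M"
  shows "(\<lambda>t. Determinant.det (mat n n (\<lambda>(i, j). E t i j))) \<in> borel_measurable M"
  unfolding det_mat_eq
  by (intro borel_measurable_sum borel_measurable_times borel_measurable_prod borel_measurable_const assms)
    (auto simp: permutes_less)

text \<open>
  The profile may depend on the row, since a collocation matrix applies the Laplacian in
  the interior rows and evaluates in the boundary rows.
\<close>
definition radial_matrix :: "(nat \<Rightarrow> real \<Rightarrow> real) \<Rightarrow> (nat \<Rightarrow> 'a::euclidean_space) \<Rightarrow> nat \<Rightarrow> real mat" where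
  "radial_matrix f c N = mat N N (\<lambda>(i, j). f i ((norm (c i - c j))\<^sup>2))"

text \<open>
  In the limit, row and column \<open>r\<close> vanish off the diagonal, and Laplace expansion along row \<open>r\<close>
  leaves a single term.
\<close>
lemma det_radial_matrix_limit:
  fixes c :: "nat \<Rightarrow> 'a::euclidean_space"
  assumes r: "r < N" and b: "norm b = 1"
    and decay: "\<And>i. i < N \<Longrightarrow> (f i \<longlongrightarrow> 0) at_top"
  shows "((\<lambda>t. Determinant.det (radial_matrix f (c(r := x + t *\<^sub>R b)) N))
    \<longlongrightarrow> f r 0 * Determinant.det (mat_delete (radial_matrix f c N) r r)) at_top"
proof -
  define B where "B i j = (if i = r \<and> j = r then f r 0 else if i = r \<or> j = r then 0
    else f i ((norm (c i - c j))\<^sup>2))" for i j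
  have "filterlim (\<lambda>t. (norm (x - y))\<^sup>2 + 2 * t * ((x - y) \<bullet> b) + t\<^sup>2) at_top at_top" for y
    by real_asymp
  moreover have "(norm (x + t *\<^sub>R b - y))\<^sup>2 = (norm (x - y))\<^sup>2 + 2 * t * ((x - y) \<bullet> b) + t\<^sup>2" for t y
    using norm_add_scaleR_unit[OF b, of "x - y" t] by (simp add: algebra_simps)
  ultimately have far: "filterlim (\<lambda>t. (norm (x + t *\<^sub>R b - y))\<^sup>2) at_top at_top" for y
    by simp
  have decay_far: "((\<lambda>t. f i ((norm (x + t *\<^sub>R b - y))\<^sup>2)) \<longlongrightarrow> 0) at_top" if "i < N" for i y
    using decay[OF that] far by (rule filterlim_compose)
  have "((\<lambda>t. Determinant.det (radial_matrix f (c(r := x + t *\<^sub>R b)) N))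
    \<longlongrightarrow> Determinant.det (mat N N (\<lambda>(i, j). B i j))) at_top"
    unfolding radial_matrix_def
  proof (rule tendsto_det_mat)
    fix i j assume ij: "i < N" "j < N"
    consider "i = r" "j = r" | "i = r" "j \<noteq> r" | "i \<noteq> r" "j = r" | "i \<noteq> r" "j \<noteq> r"
      by blast
    then show "((\<lambda>t. f i ((norm ((c(r := x + t *\<^sub>R b)) i - (c(r := x + t *\<^sub>R b)) j))\<^sup>2)) \<longlongrightarrow> B i j) at_top"
    proof cases
      case 2
      then show ?thesis
        using decay_far[OF ij(1)] by (simp add: B_def)
    next
      case 3
      then show ?thesis
        using decay_far[OF ij(1)] by (simp add: B_def norm_minus_commute)
    qed (simp_all add: B_def)
  qed
  moreover have "Determinant.det (mat N N (\<lambda>(i, j). B i j))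
      = f r 0 * Determinant.det (mat_delete (radial_matrix f c N) r r)"
  proof -
    have "Determinant.det (mat N N (\<lambda>(i, j). B i j))
        = (\<Sum>j<N. mat N N (\<lambda>(i, j). B i j) $$ (r, j) * cofactor (mat N N (\<lambda>(i, j). B i j)) r j)"
      using r by (intro laplace_expansion_row[of _ N]) auto
    also have "\<dots> = (\<Sum>j<N. if j = r then f r 0 * cofactor (mat N N (\<lambda>(i, j). B i j)) r r else 0)"
      using r by (intro sum.cong) (auto simp: B_def)
    also have "\<dots> = f r 0 * cofactor (mat N N (\<lambda>(i, j). B i j)) r r"
      using r by simp
    also have "cofactor (mat N N (\<lambda>(i, j). B i j)) r r
        = Determinant.det (mat_delete (mat N N (\<lambda>(i, j). B i j)) r r)"
      by (simp add: cofactor_def)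
    also have "mat_delete (mat N N (\<lambda>(i, j). B i j)) r r = mat_delete (radial_matrix f c N) r r"
      unfolding mat_delete_def radial_matrix_def
      by (intro cong_mat) (auto simp: B_def)
    finally show ?thesis .
  qed
  ultimately show ?thesis
    by simp
qed

lemma fsigma_open:
  fixes S :: "'a::euclidean_space set"
  assumes "open S"
  shows "fsigma S"
proof (rule open_Union_compact_subsets[OF assms])
  fix C :: "nat \<Rightarrow> 'a set"
  assume "\<And>n. compact (C n)" "\<Union>(range C) = S"
  then show ?thesis
    using fsigma.intros[of C] by (simp add: compact_imp_closed)
qed

text \<open>
  Pythagoras at the foot of the perpendicular from \<open>y\<close> to the line. The second summand is what makes the
  complexified squared distance stay in the right half plane when \<open>t\<close> is slightly off the real axis.
\<close>
lemma norm_sq_line: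
  fixes x b y :: "'a::euclidean_space"
  assumes b: "norm b = 1"
  shows "(norm (x + t *\<^sub>R b - y))\<^sup>2 = (t + (x - y) \<bullet> b)\<^sup>2 + (norm (x - y - ((x - y) \<bullet> b) *\<^sub>R b))\<^sup>2"
  using norm_add_scaleR_unit[OF b, of "x - y" t]
    norm_add_scaleR_unit[OF b, of "x - y" "- ((x - y) \<bullet> b)"]
  by (simp add: algebra_simps power2_eq_square)

text \<open>
  On a strip of half-width at most the distance of the line from every other centre, the complexified squared
  distances have positive real part, so the determinant extends holomorphically to that strip. It is
  not identically zero by the limit at infinity, hence its zeros are countable.
\<close>
lemma countable_zeros_on_line:
  fixes c :: "nat \<Rightarrow> 'a::euclidean_space"
  assumes r: "r < N" and b: "norm b = 1"
    and decay: "\<And>i. i < N \<Longrightarrow> (f i \<longlongrightarrow> 0) at_top"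
    and hol: "\<And>i. i < N \<Longrightarrow> F i holomorphic_on {w. 0 < Re w}"
    and ext: "\<And>i w. i < N \<Longrightarrow> 0 < w \<Longrightarrow> F i (of_real w) = of_real (f i w)"
    and diag: "f r 0 \<noteq> 0"
    and minor: "Determinant.det (mat_delete (radial_matrix f c N) r r) \<noteq> 0"
    and avoid: "\<And>i. i < N \<Longrightarrow> i \<noteq> r \<Longrightarrow> x - c i \<notin> span {b}"
  shows "countable {t. Determinant.det (radial_matrix f (c(r := x + t *\<^sub>R b)) N) = 0}"
proof -
  define a where "a i = (x - c i) \<bullet> b" for i
  define \<rho> where "\<rho> i = (norm (x - c i - ((x - c i) \<bullet> b) *\<^sub>R b))\<^sup>2" for i
  have line: "(norm (x + t *\<^sub>R b - c i))\<^sup>2 = (t + a i)\<^sup>2 + \<rho> i" for i t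
    unfolding a_def \<rho>_def by (rule norm_sq_line[OF b])
  have line_rev: "(norm (c i - (x + t *\<^sub>R b)))\<^sup>2 = (t + a i)\<^sup>2 + \<rho> i" for i t
    using line[of t i] by (simp only: norm_minus_commute)
  have \<rho>: "0 < \<rho> i" if "i < N" "i \<noteq> r" for i
    using avoid[OF that] unfolding \<rho>_def
    by (metis eq_iff_diff_eq_0 norm_eq_zero span_base span_scale singletonI zero_less_power2)
  \<comment> \<open>Inserting \<open>1\<close> covers the case that there is no other centre.\<close>
  define \<mu> where "\<mu> = Min (insert 1 (\<rho> ` ({..<N} - {r})))"
  have \<mu>: "0 < \<mu>" "\<And>i. i < N \<Longrightarrow> i \<noteq> r \<Longrightarrow> \<mu> \<le> \<rho> i"
    unfolding \<mu>_def using \<rho> by (auto intro!: Min_le)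
  define \<delta> where "\<delta> = sqrt \<mu>"
  define S where "S = {z. Im z < \<delta>} \<inter> {z. Im z > - \<delta>}"
  have S: "open S" "connected S"
    unfolding S_def
    by (auto intro!: open_Int open_halfspace_Im_lt open_halfspace_Im_gt convex_connected convex_Int
        convex_halfspace_Im_lt convex_halfspace_Im_gt)
  have Re_pos: "0 < Re ((z + of_real (a i))\<^sup>2 + of_real (\<rho> i))" if "z \<in> S" "i < N" "i \<noteq> r" for z i
  proof -
    have "\<bar>Im z\<bar> < \<delta>"
      using that by (auto simp: S_def)
    then have "(Im z)\<^sup>2 < \<delta>\<^sup>2"
      using power_strict_mono[of "\<bar>Im z\<bar>" \<delta> 2] by simp
    also have "\<dots> \<le> \<rho> i"
      using \<mu> that by (simp add: \<delta>_def)
    finally have "0 < (Re z + a i)\<^sup>2 - (Im z)\<^sup>2 + \<rho> i"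
      using zero_le_power2[of "Re z + a i"] by linarith
    then show ?thesis
      by (simp add: power2_eq_square)
  qed
  \<comment> \<open>The complexified matrix: the diagonal entry of the moving point is constant along the line.\<close>
  define E where "E z i j =
    (if i = r \<and> j = r then of_real (f r 0)
     else if i = r then F i ((z + of_real (a j))\<^sup>2 + of_real (\<rho> j))
     else if j = r then F i ((z + of_real (a i))\<^sup>2 + of_real (\<rho> i))
     else of_real (f i ((norm (c i - c j))\<^sup>2)))" for z i j
  define G where "G z = Determinant.det (mat N N (\<lambda>(i, j). E z i j))" for z
  define D where "D t = Determinant.det (radial_matrix f (c(r := x + t *\<^sub>R b)) N)" for t
  have holG: "G holomorphic_on S"
    unfolding G_def
  proof (rule holomorphic_on_det_mat)
    fix i j assume ij: "i < N" "j < N"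
    have comp: "(\<lambda>z. F i ((z + of_real (a k))\<^sup>2 + of_real (\<rho> k))) holomorphic_on S"
      if "k < N" "k \<noteq> r" for k
    proof -
      have "(\<lambda>z. (z + of_real (a k))\<^sup>2 + of_real (\<rho> k)) holomorphic_on S"
        by (intro holomorphic_intros)
      moreover have "(\<lambda>z. (z + of_real (a k))\<^sup>2 + of_real (\<rho> k)) ` S \<subseteq> {w. 0 < Re w}"
        using Re_pos[OF _ that] by blast
      ultimately show ?thesis
        using holomorphic_on_compose_gen[OF _ hol[OF ij(1)]] by (simp only: o_def)
    qed
    show "(\<lambda>z. E z i j) holomorphic_on S"
      unfolding E_def using comp ij by (cases "i = r"; cases "j = r") auto
  qed
  have GD: "G (of_real t) = of_real (D t)" for t
  proof -
    have pos: "0 < (t + a k)\<^sup>2 + \<rho> k" if "k < N" "k \<noteq> r" for k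
      using \<rho>[OF that] by (simp add: add_nonneg_pos)
    have ofr: "F i ((of_real t + of_real (a k))\<^sup>2 + of_real (\<rho> k)) = of_real (f i ((t + a k)\<^sup>2 + \<rho> k))"
      if "i < N" "k < N" "k \<noteq> r" for i k
      using ext[OF that(1) pos[OF that(2,3)]] by simp
    have "E (of_real t) i j = of_real (f i ((norm ((c(r := x + t *\<^sub>R b)) i - (c(r := x + t *\<^sub>R b)) j))\<^sup>2))"
      if "i < N" "j < N" for i j
      using that line_rev[of i t] by (cases "i = r"; cases "j = r") (simp_all add: E_def line ofr)
    then show ?thesis
      unfolding G_def D_def radial_matrix_def det_mat_eq
      by (auto simp: permutes_less intro!: sum.cong prod.cong)
  qed
  have "\<forall>\<^sub>F t in at_top. D t \<noteq> 0"
    unfolding D_def using diag minor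
    by (intro tendsto_imp_eventually_ne[OF det_radial_matrix_limit[OF r b decay]]) auto
  then obtain t0 where t0: "D t0 \<noteq> 0"
    by (auto dest!: eventually_happens)
  have real_S: "of_real t \<in> S" for t
    using \<mu> by (simp add: S_def \<delta>_def)
  have "countable {z \<in> S. G z = 0}"
  proof (cases "G constant_on S")
    case True
    then have "G z = G (of_real t0)" if "z \<in> S" for z
      using that real_S unfolding constant_on_def by metis
    then have "{z \<in> S. G z = 0} = {}"
      using t0 GD by auto
    then show ?thesis
      by (simp only: countable_empty)
  next
    case False
    then show ?thesis
      using S holG by (intro holomorphic_countable_zeros fsigma_open)
  qed
  then have "countable (Re ` {z \<in> S. G z = 0})"
    by (rule countable_image)
  moreover have "{t. D t = 0} \<subseteq> Re ` {z \<in> S. G z = 0}"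
    using real_S GD by (auto intro!: image_eqI[of _ Re "of_real _"])
  ultimately show ?thesis
    unfolding D_def by (rule countable_subset[rotated])
qed


section \<open>Collocation determinants\<close>

lemma invertible_mat_of_det:
  fixes A :: "'b::field mat"
  assumes A: "A \<in> carrier_mat N N" and "Determinant.det A \<noteq> 0"
  shows "invertible_mat A"
proof -
  obtain B where "B \<in> carrier_mat N N" "A * B = 1\<^sub>m N" "B * A = 1\<^sub>m N"
    using det_non_zero_imp_unit[OF assms, of "()"] A
    by (auto simp: Units_def ring_mat_def)
  then show ?thesis
    using A by (auto simp: invertible_mat_def inverts_mat_def)
qed

context gaussian_mixture
begin

text \<open>
  For a kernel vector \<open>a\<close>, the quadratic form of the matrix at \<open>a\<close> is the integral over \<open>M\<close> of the
  positive Gaussian forms, which cannot vanish.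
\<close>
lemma det_moment_matrix_nonzero:
  fixes c :: "nat \<Rightarrow> 'a::euclidean_space"
  assumes inj: "inj_on c {..<N}"
  shows "Determinant.det (radial_matrix (\<lambda>_. moment 0) c N) \<noteq> 0"
proof
  let ?A = "radial_matrix (\<lambda>_. moment 0) c N"
  assume "Determinant.det ?A = 0"
  moreover have "?A \<in> carrier_mat N N"
    by (simp add: radial_matrix_def)
  ultimately obtain v where v: "v \<in> carrier_vec N" "v \<noteq> 0\<^sub>v N" "?A *\<^sub>v v = 0\<^sub>v N"
    by (auto simp: det_0_iff_vec_prod_zero)
  define a where "a i = vec_index v i" for i
  have a: "\<exists>i\<in>{..<N}. a i \<noteq> 0"
    using v(1,2) by (auto simp: a_def intro!: eq_vecI)
  have row: "(\<Sum>j<N. moment 0 ((norm (c i - c j))\<^sup>2) * a j) = 0" if "i < N" for i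
  proof -
    have "vec_index (?A *\<^sub>v v) i = 0"
      using v(3) that by simp
    then show ?thesis
      using v(1) that
      by (simp add: radial_matrix_def a_def mult_mat_vec_def Matrix.scalar_prod_def atLeast0LessThan)
  qed
  define q where "q u = (\<Sum>i<N. \<Sum>j<N. a i * a j * exp (- ((norm (c i - c j))\<^sup>2 * h u)))" for u
  have q: "0 < q u" for u
    unfolding q_def using a inj by (intro gaussian_kernel_pos h_pos) auto
  have int: "integrable M (\<lambda>u. a i * a j * exp (- ((norm (c i - c j))\<^sup>2 * h u)))" for i j
    using integrable_moment_0 by simp
  have "(\<integral>u. q u \<partial>M) = (\<Sum>i<N. \<Sum>j<N. a i * a j * moment 0 ((norm (c i - c j))\<^sup>2))"
    unfolding q_def moment_def using int by (simp add: Bochner_Integration.integral_sum)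
  also have "\<dots> = (\<Sum>i<N. a i * (\<Sum>j<N. moment 0 ((norm (c i - c j))\<^sup>2) * a j))"
    by (simp add: sum_distrib_left mult_ac)
  also have "\<dots> = 0"
    by (simp add: row)
  finally have "AE u in M. q u = 0"
    using q int unfolding q_def
    by (subst (asm) integral_nonneg_eq_0_iff_AE) (auto simp: less_imp_le)
  then have "AE u in M. False"
    by eventually_elim (metis q less_irrefl)
  then show False
    using nontrivial by (simp add: AE_iff_null null_sets_def)
qed

definition kansa_kernel :: "nat \<Rightarrow> nat \<Rightarrow> nat \<Rightarrow> real \<Rightarrow> real" where
  "kansa_kernel d n i = (if i < n then laplacian_profile d else moment 0)"

definition complex_kansa_kernel :: "nat \<Rightarrow> nat \<Rightarrow> nat \<Rightarrow> complex \<Rightarrow> complex" where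
  "complex_kansa_kernel d n i w =
    (if i < n then 4 * (w * complex_moment 2 w) - 2 * of_nat d * complex_moment 1 w
     else complex_moment 0 w)"

lemma kansa_kernel_tendsto_0: "(kansa_kernel d n i \<longlongrightarrow> 0) at_top"
  by (simp add: kansa_kernel_def laplacian_profile_tendsto_0 moment_tendsto_0)

lemma complex_kansa_kernel_holomorphic: "complex_kansa_kernel d n i holomorphic_on {w. 0 < Re w}"
  unfolding complex_kansa_kernel_def [abs_def]
  by (cases "i < n") (auto intro!: holomorphic_intros complex_moment_holomorphic)

lemma complex_kansa_kernel_of_real:
  "complex_kansa_kernel d n i (of_real w) = of_real (kansa_kernel d n i w)"
  by (simp add: complex_kansa_kernel_def kansa_kernel_def laplacian_profile_def complex_moment_of_real)

lemma kansa_kernel_measurable [measurable]: "kansa_kernel d n i \<in> borel_measurable borel"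
  by (cases "i < n") (simp_all add: kansa_kernel_def)

definition kansa_centre :: "nat \<Rightarrow> (nat \<Rightarrow> 'a) \<Rightarrow> (nat \<Rightarrow> 'a) \<Rightarrow> nat \<Rightarrow> 'a" where
  "kansa_centre n P Q i = (if i < n then P i else Q (i - n))"

context
  fixes \<phi> :: "real \<Rightarrow> real" and \<epsilon> :: real
  assumes representation: "\<And>r. 0 \<le> r \<Longrightarrow> \<phi> (\<epsilon> * r) = moment 0 (r\<^sup>2)"
begin

lemma kansa_matrix_eq:
  fixes P Q :: "nat \<Rightarrow> 'a::euclidean_space"
  shows "kansa_matrix \<phi> \<epsilon> n P m Q
    = radial_matrix (kansa_kernel DIM('a) n) (kansa_centre n P Q) (n + m)"
  unfolding kansa_matrix_def radial_matrix_def
  by (rule eq_matI)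
    (auto simp: kansa_kernel_def kansa_centre_def laplacian_rbf[OF representation] rbf_eq_moment[OF representation])

lemma det_kansa_matrix_measurable:
  fixes X :: "'w \<Rightarrow> nat \<Rightarrow> 'a::euclidean_space"
  assumes X: "\<And>i. i < n \<Longrightarrow> (\<lambda>\<omega>. X \<omega> i) \<in> borel_measurable L"
  shows "(\<lambda>\<omega>. Determinant.det (kansa_matrix \<phi> \<epsilon> n (X \<omega>) m Q)) \<in> borel_measurable L"
  unfolding kansa_matrix_eq radial_matrix_def
proof (rule borel_measurable_det_mat)
  have [measurable]: "(\<lambda>\<omega>. kansa_centre n (X \<omega>) Q i) \<in> borel_measurable L" for i
    unfolding kansa_centre_def using X by (cases "i < n") auto
  show "(\<lambda>\<omega>. kansa_kernel DIM('a) n i ((norm (kansa_centre n (X \<omega>) Q i - kansa_centre n (X \<omega>) Q j))\<^sup>2))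
      \<in> borel_measurable L" for i j
    by measurable
qed

lemma det_kansa_matrix_0_nonzero:
  fixes Q :: "nat \<Rightarrow> 'a::euclidean_space"
  assumes "inj_on Q {..<m}"
  shows "Determinant.det (kansa_matrix \<phi> \<epsilon> 0 P m Q) \<noteq> 0"
proof -
  have "kansa_matrix \<phi> \<epsilon> 0 P m Q = radial_matrix (\<lambda>_. moment 0) Q m"
    unfolding kansa_matrix_eq by (simp add: radial_matrix_def kansa_kernel_def kansa_centre_def)
  then show ?thesis
    using det_moment_matrix_nonzero[OF assms] by simp
qed

text \<open>Dropping the row and the column of the last interior point recovers the smaller matrix.\<close>
lemma kansa_matrix_minor:
  fixes P Q :: "nat \<Rightarrow> 'a::euclidean_space"
  shows "mat_delete (kansa_matrix \<phi> \<epsilon> (Suc n) P m Q) n n = kansa_matrix \<phi> \<epsilon> n P m Q"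
  unfolding kansa_matrix_eq
  by (rule eq_matI)
    (auto simp: mat_delete_def radial_matrix_def kansa_kernel_def kansa_centre_def)

lemma kansa_matrix_cong:
  assumes "\<And>i. i < n \<Longrightarrow> P i = P' i"
  shows "kansa_matrix \<phi> \<epsilon> n P m Q = kansa_matrix \<phi> \<epsilon> n P' m Q"
  unfolding kansa_matrix_def using assms
  by (intro arg_cong4[where f = four_block_mat] cong_mat) auto

text \<open>
  The new point occupies row and column \<open>n\<close>. Its diagonal entry is the Laplacian of its own basis
  function at the centre, and deleting its row and column gives the old matrix.
\<close>
lemma AE_det_kansa_matrix_Suc:
  fixes P Q :: "nat \<Rightarrow> 'a::euclidean_space"
  assumes dim: "DIM('a) \<ge> 2"
    and nz: "Determinant.det (kansa_matrix \<phi> \<epsilon> n P m Q) \<noteq> 0"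
  shows "AE x in lborel. Determinant.det (kansa_matrix \<phi> \<epsilon> (Suc n) (P(n := x)) m Q) \<noteq> 0"
proof -
  let ?N = "Suc n + m" and ?f = "kansa_kernel DIM('a) (Suc n)" and ?c = "kansa_centre (Suc n) P Q"
  let ?D = "\<lambda>x. Determinant.det (kansa_matrix \<phi> \<epsilon> (Suc n) (P(n := x)) m Q)"
  obtain b :: 'a where b: "b \<in> Basis"
    by (meson nonempty_Basis ex_in_conv)
  have D: "?D x = Determinant.det (radial_matrix ?f (?c(n := x)) ?N)" for x
    unfolding kansa_matrix_eq
    by (intro arg_cong[where f = Determinant.det] arg_cong[where f = "\<lambda>c. radial_matrix ?f c ?N"])
      (auto simp: kansa_centre_def fun_eq_iff)
  have "AE x in lborel. x \<notin> {x. ?D x = 0}"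
  proof (rule AE_lborel_of_lines)
    have "?D \<in> borel_measurable borel"
      by (rule det_kansa_matrix_measurable) (auto simp: fun_upd_def)
    from borel_measurable_eq[OF this borel_measurable_const]
    show "{x. ?D x = 0} \<in> sets borel"
      by simp
    have "AE x in lborel. \<forall>i\<in>{..<?N} - {n}. x - ?c i \<notin> span {b}"
      by (intro AE_finite_allI AE_line_avoids dim) simp
    then show "AE x in lborel. AE t in lborel. x + t *\<^sub>R b \<notin> {x. ?D x = 0}"
    proof eventually_elim
      case (elim x)
      have "countable {t. Determinant.det (radial_matrix ?f (?c(n := x + t *\<^sub>R b)) ?N) = 0}"
      proof (rule countable_zeros_on_line[where F = "complex_kansa_kernel DIM('a) (Suc n)"])
        show "Determinant.det (mat_delete (radial_matrix ?f ?c ?N) n n) \<noteq> 0"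
          using nz unfolding kansa_matrix_eq[symmetric] kansa_matrix_minor .
        show "?f n 0 \<noteq> 0"
          using laplacian_profile_0_neg[OF DIM_positive[where 'a = 'a]] by (simp add: kansa_kernel_def)
      qed (use b elim in \<open>auto simp: kansa_kernel_tendsto_0 complex_kansa_kernel_holomorphic
          complex_kansa_kernel_of_real\<close>)
      then have "AE t in lborel. t \<notin> {t. Determinant.det (radial_matrix ?f (?c(n := x + t *\<^sub>R b)) ?N) = 0}"
        by (intro AE_not_in countable_imp_null_set_lborel)
      then show ?case
        unfolding D by simp
    qed
  qed
  then show ?thesis
    by simp
qed

text \<open>
  The first \<open>n\<close> points and the next one are independent, so their joint law is a product measure.
  The configurations where adding the next point makes a nonsingular matrix singular form a
  measurable set whose sections are null by the preceding lemma, hence a null set.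
\<close>
lemma AE_det_kansa_matrix:
  fixes P :: "nat \<Rightarrow> 'w \<Rightarrow> 'a::euclidean_space" and Q :: "nat \<Rightarrow> 'a"
  assumes dim: "DIM('a) \<ge> 2" and Q: "inj_on Q {..<m}"
    and "prob_space L" and indep: "prob_space.indep_vars L (\<lambda>_. borel) P UNIV"
    and abs_cont: "\<And>i Z. Z \<in> null_sets lborel \<Longrightarrow> AE \<omega> in L. P i \<omega> \<notin> Z"
  shows "AE \<omega> in L. Determinant.det (kansa_matrix \<phi> \<epsilon> n (\<lambda>i. P i \<omega>) m Q) \<noteq> 0"
proof (induction n)
  case 0
  show ?case
    using det_kansa_matrix_0_nonzero[OF Q] by simp
next
  case (Suc n)
  interpret L: prob_space L by fact
  have P [measurable]: "P i \<in> borel_measurable L" for i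
    using indep by (simp add: L.indep_vars_def)
  let ?K = "\<lambda>n p. Determinant.det (kansa_matrix \<phi> \<epsilon> n p m Q)"
  define X where "X \<omega> = restrict (\<lambda>i. P i \<omega>) {..<n}" for \<omega>
  \<comment> \<open>The next point is kept as a family over a singleton index set, so that both random variables
    take values in the same type.\<close>
  define Y where "Y \<omega> = restrict (\<lambda>i. P i \<omega>) {n}" for \<omega>
  let ?A = "Pi\<^sub>M {..<n} (\<lambda>_. borel) :: (nat \<Rightarrow> 'a) measure"
  let ?B = "Pi\<^sub>M {n} (\<lambda>_. borel) :: (nat \<Rightarrow> 'a) measure"
  have X [measurable]: "X \<in> measurable L ?A" and Y [measurable]: "Y \<in> measurable L ?B"
    unfolding X_def Y_def by measurable
  have "L.indep_var ?A X ?B Y"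
    unfolding X_def Y_def by (rule L.indep_var_restrict[OF indep]) auto
  then have joint: "distr L (?A \<Otimes>\<^sub>M ?B) (\<lambda>\<omega>. (X \<omega>, Y \<omega>)) = distr L ?A X \<Otimes>\<^sub>M distr L ?B Y"
    by (simp add: L.indep_var_distribution_eq)
  interpret dX: prob_space "distr L ?A X"
    by (rule L.prob_space_distr) measurable
  interpret dY: prob_space "distr L ?B Y"
    by (rule L.prob_space_distr) measurable
  interpret pair_sigma_finite "distr L ?A X" "distr L ?B Y" ..
  have [measurable]: "(\<lambda>z. ?K n (fst z)) \<in> borel_measurable (?A \<Otimes>\<^sub>M ?B)"
    by (rule det_kansa_matrix_measurable) measurable
  have [measurable]: "(\<lambda>z. ?K (Suc n) ((fst z)(n := snd z n))) \<in> borel_measurable (?A \<Otimes>\<^sub>M ?B)"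
  proof (rule det_kansa_matrix_measurable)
    show "(\<lambda>z. ((fst z)(n := snd z n)) i) \<in> borel_measurable (?A \<Otimes>\<^sub>M ?B)" if "i < Suc n" for i
      using that by (cases "i = n") (simp_all, measurable)
  qed
  let ?good = "\<lambda>z. ?K n (fst z) \<noteq> 0 \<longrightarrow> ?K (Suc n) ((fst z)(n := snd z n)) \<noteq> 0"
  have good: "{z \<in> space (?A \<Otimes>\<^sub>M ?B). ?good z} \<in> sets (?A \<Otimes>\<^sub>M ?B)"
    by measurable
  have "AE z in distr L ?A X \<Otimes>\<^sub>M distr L ?B Y. ?good z"
  proof (rule AE_pair_measure)
    show "{z \<in> space (distr L ?A X \<Otimes>\<^sub>M distr L ?B Y). ?good z} \<in> sets (distr L ?A X \<Otimes>\<^sub>M distr L ?B Y)"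
      using good by (simp add: space_pair_measure cong: sets_pair_measure_cong)
    have "AE y in distr L ?B Y. ?good (p, y)" for p
    proof (cases "?K n p = 0")
      case False
      define Z where "Z = {x. ?K (Suc n) (p(n := x)) = 0}"
      have "(\<lambda>x. ?K (Suc n) (p(n := x))) \<in> borel_measurable borel"
        by (rule det_kansa_matrix_measurable) (auto simp: fun_upd_def)
      from borel_measurable_eq[OF this borel_measurable_const]
      have Z [measurable]: "Z \<in> sets borel"
        by (simp add: Z_def)
      have "AE x in lborel. x \<notin> Z"
        using AE_det_kansa_matrix_Suc[OF dim False] by (simp add: Z_def)
      then have "Z \<in> null_sets lborel"
        using Z by (simp add: AE_iff_null_sets)
      then have "AE \<omega> in L. Y \<omega> n \<notin> Z"
        using abs_cont[of Z n] by (simp add: Y_def)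
      then have "AE y in distr L ?B Y. y n \<notin> Z"
        by (subst AE_distr_iff) measurable
      then show ?thesis
        by (simp add: Z_def)
    qed simp
    then show "AE p in distr L ?A X. AE y in distr L ?B Y. ?good (p, y)"
      by (rule AE_I2)
  qed
  then have "AE \<omega> in L. ?good (X \<omega>, Y \<omega>)"
    unfolding joint[symmetric] using good by (subst (asm) AE_distr_iff) auto
  with Suc.IH show ?case
  proof eventually_elim
    case (elim \<omega>)
    have "kansa_matrix \<phi> \<epsilon> n (X \<omega>) m Q = kansa_matrix \<phi> \<epsilon> n (\<lambda>i. P i \<omega>) m Q"
      by (rule kansa_matrix_cong) (simp add: X_def)
    moreover have "kansa_matrix \<phi> \<epsilon> (Suc n) ((X \<omega>)(n := Y \<omega> n)) m Q
        = kansa_matrix \<phi> \<epsilon> (Suc n) (\<lambda>i. P i \<omega>) m Q"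
      by (rule kansa_matrix_cong) (auto simp: X_def Y_def less_Suc_eq)
    ultimately show ?case
      using elim by simp
  qed
qed

end
end


section \<open>Almost sure nonsingularity\<close>

lemma AE_notin_of_density_law:
  fixes X :: "'w \<Rightarrow> 'a::euclidean_space" and \<sigma> :: "'a \<Rightarrow> real"
  assumes "finite_measure M" and [measurable]: "X \<in> borel_measurable M"
    and law: "\<And>A. A \<in> sets borel \<Longrightarrow>
      measure M {\<omega> \<in> space M. X \<omega> \<in> A} = (LINT x:A \<inter> \<Omega>|lebesgue. \<sigma> x)"
    and Z: "Z \<in> null_sets lborel"
  shows "AE \<omega> in M. X \<omega> \<notin> Z"
proof -
  interpret finite_measure M by fact
  have [measurable]: "Z \<in> sets borel"
    using Z by auto
  have "Z \<in> null_sets lebesgue"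
    using Z by (rule null_sets_completionI)
  then have "AE x in lebesgue. indicator (Z \<inter> \<Omega>) x *\<^sub>R \<sigma> x = 0"
    by (rule AE_mp[OF AE_not_in]) (auto intro!: AE_I2 simp: indicator_def)
  then have "(LINT x:Z \<inter> \<Omega>|lebesgue. \<sigma> x) = 0"
    unfolding set_lebesgue_integral_def by (rule integral_eq_zero_AE)
  then have "measure M {\<omega> \<in> space M. X \<omega> \<in> Z} = 0"
    using law[of Z] by simp
  then have "emeasure M {\<omega> \<in> space M. X \<omega> \<in> Z} = 0"
    by (simp add: emeasure_eq_measure)
  then show ?thesis
    by (intro AE_I[of _ _ "{\<omega> \<in> space M. X \<omega> \<in> Z}"]) auto
qed

theorem corollary1:
  fixes \<Omega> :: "'a::euclidean_space set"
    and \<epsilon> :: real and \<phi> :: "real \<Rightarrow> real"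
    and M :: "'w measure" and \<sigma> :: "'a \<Rightarrow> real"
    and P :: "nat \<Rightarrow> 'w \<Rightarrow> 'a" and Q :: "nat \<Rightarrow> 'a" and n m :: nat
  assumes dim: "DIM('a) \<ge> 2"
    and domain: "open \<Omega>" "connected \<Omega>" "\<Omega> \<noteq> {}" "bounded \<Omega>"
    and eps: "\<epsilon> > 0"
    and phi: "\<phi> = gaussian \<or> (\<exists>\<beta><0. \<phi> = gimq \<beta>) \<or> (\<exists>\<nu>>1. \<phi> = matern \<nu>)"
    and m: "m \<ge> 1"
    and Q: "inj_on Q {..<m}" "Q ` {..<m} \<subseteq> frontier \<Omega>"
    and sigma_nonneg: "\<And>x. x \<in> \<Omega> \<Longrightarrow> \<sigma> x \<ge> 0"
    and sigma_integrable: "set_integrable lebesgue \<Omega> \<sigma>"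
    and sigma_integral: "(LINT x:\<Omega>|lebesgue. \<sigma> x) = 1"
    and prob_space: "prob_space M"
    and indep: "prob_space.indep_vars M (\<lambda>_. borel) P UNIV"
    and P_in: "\<And>i \<omega>. \<omega> \<in> space M \<Longrightarrow> P i \<omega> \<in> \<Omega>"
    and law: "\<And>i A. A \<in> sets borel \<Longrightarrow>
           measure M {\<omega> \<in> space M. P i \<omega> \<in> A} = (LINT x:A \<inter> \<Omega>|lebesgue. \<sigma> x)"
  shows "AE \<omega> in M. invertible_mat (kansa_matrix \<phi> \<epsilon> n (\<lambda>i. P i \<omega>) m Q)"
proof -
  note prob_space_M = prob_space
  interpret prob_space M by fact
  have "mixture_representation \<phi> 1"
    using phi gaussian_mixture_representation gimq_mixture_representation matern_mixture_representation
    by blast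
  then have "mixture_representation \<phi> \<epsilon>"
    using eps by (rule mixture_representation_scale)
  then obtain K :: "real measure" and h where K: "gaussian_mixture K h"
    and rep: "\<And>r. 0 \<le> r \<Longrightarrow> \<phi> (\<epsilon> * r) = (\<integral>v. exp (- (r\<^sup>2 * h v)) \<partial>K)"
    unfolding mixture_representation_def by blast
  interpret mix: gaussian_mixture K h
    by fact
  have rep': "\<phi> (\<epsilon> * r) = mix.moment 0 (r\<^sup>2)" if "0 \<le> r" for r
    using rep[OF that] by (simp add: mix.moment_def)
  have P_measurable: "P i \<in> borel_measurable M" for i
    using indep by (simp add: indep_vars_def)
  have "AE \<omega> in M. P i \<omega> \<notin> Z" if "Z \<in> null_sets lborel" for i Z
    using finite_measure_axioms P_measurable law that by (rule AE_notin_of_density_law)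
  then have "AE \<omega> in M. Determinant.det (kansa_matrix \<phi> \<epsilon> n (\<lambda>i. P i \<omega>) m Q) \<noteq> 0"
    using mix.AE_det_kansa_matrix[OF rep' dim Q(1) prob_space_M indep] by blast
  then show ?thesis
  proof eventually_elim
    case (elim \<omega>)
    have "kansa_matrix \<phi> \<epsilon> n (\<lambda>i. P i \<omega>) m Q \<in> carrier_mat (n + m) (n + m)"
      by (simp add: kansa_matrix_def)
    then show ?case
      using elim by (rule invertible_mat_of_det)
  qed
qed

end
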